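(* Assume the setting described in the context, with $\acute A$ and $\grave A$ standard preferred sets. Then: (i) every element of $\mathcal{C}^*$ is a finite sum (repetitions allowed) of elements of $\Pi^*=\{\pi_1,\dots,\pi_t\}$, i.e. $\Pi^*$ is a weak spanning set for $\mathcal C^*$; (ii) the ordered set $\vartheta=(\vartheta_1,\dots,\vartheta_t)$, $\vartheta_i=\mathbb T(\pi_i)$, of admissible prime transvectants is a Hilbert basis for $\mathcal J=\ker\mathcal X\subset\mathbb R[[\mathbf x,\mathbf y]]$: each $\vartheta_i$ is a homogeneous weight invariant in $\mathcal J$, and every element of $\mathcal J$ is a (possibly countably infinite, formal) linear combination of the monomials $\vartheta^{\mathbf K}=\vartheta_1^{K_1}\cdots\vartheta_t^{K_t}$, $\mathbf K\in\mathbb N^t$.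
   Context: $\mathbb N=\{0,1,2,\dots\}$. An $\mathfrak{sl}_2$ triad is a triple $(X,Y,Z)$ of linear operators with $[X,Y]=Z$, $[Z,X]=2X$, $[Z,Y]=-2Y$. For a real $n\times n$ matrix $A$ and $f\in\mathbb R[[\mathbf x]]$, $\mathbf x=(x_1,\dots,x_n)$, put $\mathcal D_Af(\mathbf x)=f'(\mathbf x)A\mathbf x$ (gradient row vector times $A\mathbf x$). Let $(\acute X,\acute Y,\acute Z)$ be an $\mathfrak{sl}_2$ triad of real $n\times n$ matrices and $(\grave X,\grave Y,\grave Z)$ one of real $m\times m$ matrices. On $\mathbb R[[\mathbf x]]$ set $\acute{\mathcal X}=\mathcal D_{\acute Y}$, $\acute{\mathcal Y}=\mathcal D_{\acute X}$, $\acute{\mathcal Z}=\mathcal D_{\acute Z}$; on $\mathbb R[[\mathbf y]]$, $\mathbf y=(y_1,\dots,y_m)$, set $\grave{\mathcal X}=\mathcal D_{\grave Y}$, $\grave{\mathcal Y}=\mathcal D_{\grave X}$, $\grave{\mathcal Z}=\mathcal D_{\grave Z}$. These act on $\mathbb R[[\mathbf x,\mathbf y]]$ (acting only on the $\mathbf x$, resp. $\mathbf y$, variables), and $\mathcal X=\acute{\mathcal X}+\grave{\mathcal X}$, $\mathcal Y=\acute{\mathcal Y}+\grave{\mathcal Y}$, $\mathcal Z=\acute{\mathcal Z}+\grave{\mathcal Z}$ (these are $\mathcal D$ of the block-diagonal matrices). Put $\acute{\mathcal J}=\ker\acute{\mathcal X}\subset\mathbb R[[\mathbf x]]$, $\grave{\mathcal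 J}=\ker\grave{\mathcal X}\subset\mathbb R[[\mathbf y]]$, $\mathcal J=\ker\mathcal X\subset\mathbb R[[\mathbf x,\mathbf y]]$. A weight invariant of $\acute{\mathcal J}$ is $f\in\acute{\mathcal J}$ with $\acute{\mathcal Z}f=\widehat f\,f$ for an integer $\widehat f$ (its weight); similarly for $\grave{\mathcal J}$ and $\mathcal J$. A Hilbert basis of $\acute{\mathcal J}$ is a tuple $\alpha=(\alpha_1,\dots,\alpha_p)$ of homogeneous weight invariants (weights $\widehat\alpha_i$) such that every element of $\acute{\mathcal J}$ is a countable linear combination of monomials $\alpha^{\mathbf k}=\alpha_1^{k_1}\cdots\alpha_p^{k_p}$, $\mathbf k\in\mathbb N^p$; write $\widehat\alpha\mathbf k=\sum\widehat\alpha_ik_i$. Similarly $\beta=(\beta_1,\dots,\beta_q)$ is a Hilbert basis of $\grave{\mathcal J}$, $\widehat\beta\boldsymbol\ell=\sum\widehat\beta_j\ell_j$. A preferred set for $\alpha$ is a set $\acute A\subset\mathbb N^p$ such that the polynomials $\alpha^{\mathbf k}$, $\mathbf k\in\acute A$, are pairwise distinct, linearly independent, and every element of $\acute{\mathcal J}$ is a countable linear combination of them; it is standard if $\mathbf k\in\acute A$ and $\mathbf k'\le\mathbf k$ componentwise ($\mathbf k'\in\mathbb N^p$) imply $\mathbf k'\in\acute A$. Let $\acute A$ (for $\alpha$) and $\grave A$ (for $\beta$) be standard preferred sets. External transvectant: for weight invariants $f\in\acute{\mathcal J}$, $g\in\grave{\mathcal J}$ and an integer $s$ with $0\le s\le\widehat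 f$, $0\le s\le\widehat g$, $(f,g)^{(s)}=\sum_{j=0}^s(-1)^j W^{sj}_{fg}(\acute{\mathcal Y}^jf)(\grave{\mathcal Y}^{s-j}g)$, $W^{sj}_{fg}=\binom sj\frac{(\widehat f-j)!}{(\widehat f-s)!}\frac{(\widehat g-s+j)!}{(\widehat g-s)!}$. Transvectant cone: $\mathcal C=\{(\mathbf k;\boldsymbol\ell;s)\in\mathbb N^{p+q+1}: s\le\widehat\alpha\mathbf k,\ s\le\widehat\beta\boldsymbol\ell\}$; transvectant map $\mathbb T(\mathbf k;\boldsymbol\ell;s)=(\alpha^{\mathbf k},\beta^{\boldsymbol\ell})^{(s)}$. $\mathcal C^*=\{(\mathbf k;\boldsymbol\ell;s)\in\mathcal C:\mathbf k\in\acute A,\boldsymbol\ell\in\grave A\}$ (admissible elements). A prime is a nonzero element of $\mathcal C$ that is not a sum of two nonzero elements of $\mathcal C$; the set $\Pi$ of primes is finite. $\Pi^*=\Pi\cap\mathcal C^*=\{\pi_1,\dots,\pi_t\}$ (admissible primes), listed in some fixed order, and $\vartheta_i=\mathbb T(\pi_i)$. *)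

theory Defs
  imports "HOL-Analysis.Analysis"
begin

text \<open>Variables are the elements of a finite type 'v (so R[[x_1..x_n]] with n = CARD('v)).
  A monomial is an exponent vector 'v => nat; a formal power series is its coefficient function.\<close>

type_synonym 'v mps = "('v \<Rightarrow> nat) \<Rightarrow> real"

definition mps_zero :: "'v mps" where
  "mps_zero = (\<lambda>_. 0)"

definition mps_one :: "'v mps" where
  "mps_one = (\<lambda>m. if m = (\<lambda>_. 0) then 1 else 0)"

definition mps_mult :: "'v::finite mps \<Rightarrow> 'v mps \<Rightarrow> 'v mps" where
  "mps_mult f g = (\<lambda>m. \<Sum>a\<in>{a. \<forall>v. a v \<le> m v}. f a * g (\<lambda>v. m v - a v))"

primrec mps_pow :: "'v::finite mps \<Rightarrow> nat \<Rightarrow> 'v mps" where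
  "mps_pow f 0 = mps_one"
| "mps_pow f (Suc n) = mps_mult f (mps_pow f n)"

fun smono :: "'v::finite mps list \<Rightarrow> nat list \<Rightarrow> 'v mps" where
  "smono (a # as) (k # ks) = mps_mult (mps_pow a k) (smono as ks)"
| "smono _ _ = mps_one"

definition homogeneous :: "'v::finite mps \<Rightarrow> bool" where
  "homogeneous f \<longleftrightarrow> (\<exists>d. \<forall>m. f m \<noteq> 0 \<longrightarrow> (\<Sum>v\<in>UNIV. m v) = d)"

text \<open>D_A f (x) = f'(x) A x = sum_i sum_j A_ij x_j (d f / d x_i), coefficientwise.\<close>
definition Dop :: "real^'v^'v \<Rightarrow> 'v::finite mps \<Rightarrow> 'v mps" where
  "Dop A f = (\<lambda>m. \<Sum>i\<in>UNIV. \<Sum>j\<in>UNIV.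
      A $ i $ j * (if 0 < m j
        then (let m' = m(j := m j - 1) in real (m' i + 1) * f (m'(i := m' i + 1)))
        else 0))"

definition bdiag :: "real^'a^'a \<Rightarrow> real^'b^'b \<Rightarrow> real^('a + 'b)^('a + 'b)" where
  "bdiag A B = (\<chi> u v. (case u of
       Inl i \<Rightarrow> (case v of Inl j \<Rightarrow> A $ i $ j | Inr _ \<Rightarrow> 0)
     | Inr i \<Rightarrow> (case v of Inl _ \<Rightarrow> 0 | Inr j \<Rightarrow> B $ i $ j)))"

definition tens :: "'a mps \<Rightarrow> 'b mps \<Rightarrow> ('a + 'b) mps" where
  "tens f g = (\<lambda>m. f (\<lambda>a. m (Inl a)) * g (\<lambda>b. m (Inr b)))"

definition sl2_triad :: "real^'n^'n \<Rightarrow> real^'n^'n \<Rightarrow> real^'n^'n \<Rightarrow> bool" where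
  "sl2_triad X Y Z \<longleftrightarrow> X ** Y - Y ** X = Z \<and> Z ** X - X ** Z = 2 *\<^sub>R X
      \<and> Z ** Y - Y ** Z = - (2 *\<^sub>R Y)"

text \<open>f is a (possibly countably infinite, formal) linear combination of the family F i, i in I:
  each coefficient of the sum is a finite sum (local finiteness, equivalent to convergence in the
  formal topology since there are finitely many variables).\<close>
definition is_lincomb :: "('i \<Rightarrow> 'v mps) \<Rightarrow> 'i set \<Rightarrow> 'v mps \<Rightarrow> bool" where
  "is_lincomb F I f \<longleftrightarrow> (\<exists>c :: 'i \<Rightarrow> real. \<forall>m.
      finite {i\<in>I. c i * F i m \<noteq> 0} \<and> f m = (\<Sum>i\<in>{i\<in>I. c i * F i m \<noteq> 0}. c i * F i m))"

definition hilbert_basis ::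
  "('v::finite mps \<Rightarrow> 'v mps) \<Rightarrow> ('v mps \<Rightarrow> 'v mps) \<Rightarrow> 'v mps list \<Rightarrow> int list \<Rightarrow> bool" where
  "hilbert_basis DX DZ bs ws \<longleftrightarrow> length ws = length bs
     \<and> (\<forall>i<length bs. DX (bs ! i) = mps_zero \<and> homogeneous (bs ! i)
           \<and> DZ (bs ! i) = (\<lambda>m. of_int (ws ! i) * (bs ! i) m))
     \<and> (\<forall>f. DX f = mps_zero \<longrightarrow> is_lincomb (smono bs) {k. length k = length bs} f)"

definition preferred_set :: "('v::finite mps \<Rightarrow> 'v mps) \<Rightarrow> 'v mps list \<Rightarrow> nat list set \<Rightarrow> bool" where
  "preferred_set DX bs A \<longleftrightarrow> A \<subseteq> {k. length k = length bs}
     \<and> inj_on (smono bs) A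
     \<and> (\<forall>F c. finite F \<longrightarrow> F \<subseteq> A \<longrightarrow> (\<forall>m. (\<Sum>k\<in>F. c k * smono bs k m) = 0)
            \<longrightarrow> (\<forall>k\<in>F. c k = (0::real)))
     \<and> (\<forall>f. DX f = mps_zero \<longrightarrow> is_lincomb (smono bs) A f)"

definition standard_set :: "nat list set \<Rightarrow> bool" where
  "standard_set A \<longleftrightarrow> (\<forall>k\<in>A. \<forall>k'. length k' = length k \<and> (\<forall>i<length k. k' ! i \<le> k ! i) \<longrightarrow> k' \<in> A)"

definition wsum :: "int list \<Rightarrow> nat list \<Rightarrow> int" where
  "wsum w k = sum_list (map2 (\<lambda>a b. a * int b) w k)"

text \<open>External transvectant (f,g)^(s); Ya, Yb are the matrices whose D gives the operators Y
  (i.e. the acute/grave X matrices); wF, wG are the weights of f, g.\<close>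
definition transv :: "real^'a^'a \<Rightarrow> real^'b^'b \<Rightarrow> int \<Rightarrow> int \<Rightarrow> nat
    \<Rightarrow> 'a::finite mps \<Rightarrow> 'b::finite mps \<Rightarrow> ('a + 'b) mps" where
  "transv Ya Yb wF wG s f g = (\<lambda>m. \<Sum>j\<le>s. (-1) ^ j *
      (real (s choose j) * fact (nat (wF - int j)) / fact (nat (wF - int s))
        * fact (nat (wG - int s + int j)) / fact (nat (wG - int s)))
      * tens ((Dop Ya ^^ j) f) ((Dop Yb ^^ (s - j)) g) m)"

type_synonym cone_elt = "nat list \<times> nat list \<times> nat"

definition in_cone :: "int list \<Rightarrow> int list \<Rightarrow> cone_elt \<Rightarrow> bool" where
  "in_cone wa wb c = (case c of (k, l, s) \<Rightarrow> length k = length wa \<and> length l = length wb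
       \<and> int s \<le> wsum wa k \<and> int s \<le> wsum wb l)"

definition czero :: "nat \<Rightarrow> nat \<Rightarrow> cone_elt" where
  "czero p q = (replicate p 0, replicate q 0, 0)"

definition cadd :: "cone_elt \<Rightarrow> cone_elt \<Rightarrow> cone_elt" where
  "cadd c d = (case c of (k, l, s) \<Rightarrow> case d of (k', l', s') \<Rightarrow>
      (map2 (+) k k', map2 (+) l l', s + s'))"

definition cone_prime :: "int list \<Rightarrow> int list \<Rightarrow> cone_elt \<Rightarrow> bool" where
  "cone_prime wa wb c \<longleftrightarrow> in_cone wa wb c \<and> c \<noteq> czero (length wa) (length wb)
     \<and> \<not> (\<exists>a b. in_cone wa wb a \<and> in_cone wa wb b \<and> a \<noteq> czero (length wa) (length wb)
              \<and> b \<noteq> czero (length wa) (length wb) \<and> c = cadd a b)"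

definition admissible :: "nat list set \<Rightarrow> nat list set \<Rightarrow> cone_elt \<Rightarrow> bool" where
  "admissible Aa Ab c = (case c of (k, l, s) \<Rightarrow> k \<in> Aa \<and> l \<in> Ab)"

definition Tmap :: "real^'a^'a \<Rightarrow> real^'b^'b \<Rightarrow> 'a::finite mps list \<Rightarrow> int list
    \<Rightarrow> 'b::finite mps list \<Rightarrow> int list \<Rightarrow> cone_elt \<Rightarrow> ('a + 'b) mps" where
  "Tmap Ya Yb \<alpha> wa \<beta> wb c = (case c of (k, l, s) \<Rightarrow>
      transv Ya Yb (wsum wa k) (wsum wb l) s (smono \<alpha> k) (smono \<beta> l))"

end

theory Submission
  imports Defs
begin

text \<open>Write \<open>x1\<close> and \<open>x2\<close> for the two commuting raising derivations, so that \<open>J\<close> is the kernel of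
  \<open>x1 + x2\<close>. Let \<open>h\<close> in \<open>J\<close> be bihomogeneous, \<open>x2^(s+1) h = 0\<close> and \<open>u = x2^s h\<close>. As \<open>x1 h = - x2 h\<close>,
  the leading term \<open>u\<close> lies in both kernels and, up to sign, in the image of both \<open>x1^s\<close> and \<open>x2^s\<close>.
  Hence \<open>u\<close> is a combination of products \<open>\<alpha>^k \<beta>^l\<close> whose two weights are at least \<open>s\<close>, that is, with
  \<open>(k; l; s)\<close> in the admissible cone. Decompose \<open>(k; l; s)\<close> into admissible primes. The transvectant
  of \<open>(k'; l'; s')\<close> has leading term a positive multiple of \<open>\<alpha>^k' \<beta>^l'\<close>, and leading terms are
  multiplicative up to positive factors by the Leibniz rule, so the product of the corresponding
  prime transvectants has leading term a positive multiple of \<open>\<alpha>^k \<beta>^l\<close>. Subtracting such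
  products from \<open>h\<close> lowers \<open>s\<close>.\<close>

text \<open>The delicate point is the bound on the weights. The leading term \<open>u\<close> is in
  general not a weight vector but a sum of weight vectors, so being an \<open>s\<close>-fold image
  has to be turned into a condition on each summand. Linear independence of the preferred monomials
  makes this possible: every coefficient can be followed separately while \<open>z - s\<close>,
  \<open>z - (s + 1)\<close>, ... are applied. Neither complete reducibility nor a dimension count
  enters; nilpotency of the raising operators on each bihomogeneous component is enough.
  Standardness acts twice. It keeps all prime summands of an admissible element admissible, and it
  prevents constant generators from occurring in preferred monomials, so that only finitely many
  preferred exponents belong to each degree. A Hilbert basis has to span, not to be independent.
  Hence any decomposition into primes may be chosen, and only positivity of the leading factors
  matters, never their values. Infinite sums appear only at the very end, when the finite expansions
  of the bihomogeneous components are glued.\<close>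

section \<open>The ring of formal power series\<close>

text \<open>The plain function type \<open>'v mps\<close> cannot carry the convolution product as its type class
  multiplication, hence a copy.\<close>

typedef 'v mser = "UNIV :: 'v mps set" morphisms coeff Ser ..

lemma coeff_Ser [simp]: "coeff (Ser f) = f"
  by (simp add: Ser_inverse)

lemma Ser_coeff [simp]: "Ser (coeff f) = f"
  by (simp add: coeff_inverse)

lemma mser_eqI: "(\<And>m. coeff f m = coeff g m) \<Longrightarrow> f = g"
  by (metis coeff_inject ext)

lemma Ser_inject' [simp]: "Ser f = Ser g \<longleftrightarrow> f = g"
  by (simp add: Ser_inject)

instantiation mser :: (type) real_vector
begin
definition "0 = Ser (\<lambda>_. 0)"
definition "f + g = Ser (\<lambda>m. coeff f m + coeff g m)"
definition "- f = Ser (\<lambda>m. - coeff f m)"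
definition "f - g = Ser (\<lambda>m. coeff f m - coeff g m)"
definition "scaleR c f = Ser (\<lambda>m. c * coeff f m)"
instance
  by standard (auto simp: zero_mser_def plus_mser_def uminus_mser_def minus_mser_def
      scaleR_mser_def algebra_simps)
end

lemma coeff_0 [simp]: "coeff 0 m = 0"
  by (simp add: zero_mser_def)
lemma coeff_add [simp]: "coeff (f + g) m = coeff f m + coeff g m"
  by (simp add: plus_mser_def)
lemma coeff_diff [simp]: "coeff (f - g) m = coeff f m - coeff g m"
  by (simp add: minus_mser_def)
lemma coeff_scaleR [simp]: "coeff (c *\<^sub>R f) m = c * coeff f m"
  by (simp add: scaleR_mser_def)
lemma coeff_sum: "coeff (sum f I) m = (\<Sum>i\<in>I. coeff (f i) m)"
  by (induction I rule: infinite_finite_induct) auto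

lemma finite_le_fun [simp]: "finite {a. \<forall>v. a v \<le> (m :: 'v::finite \<Rightarrow> nat) v}"
proof -
  have "{a. \<forall>v. a v \<le> m v} = PiE UNIV (\<lambda>v. {..m v})"
    by (auto simp: PiE_def Pi_def extensional_def)
  thus ?thesis by (simp add: finite_PiE)
qed

text \<open>The form symmetric in both factors: commutativity, associativity and the Leibniz rule
  become reindexings without truncated subtraction in the summand.\<close>

lemma mps_mult_pairs:
  "mps_mult f g m = (\<Sum>(a, b)\<in>{(a, b). (\<lambda>v. a v + b v) = m}. f a * g b)"
  unfolding mps_mult_def
  by (rule sum.reindex_bij_witness[of _ fst "\<lambda>a. (a, \<lambda>v. m v - a v)"])
     (auto simp: fun_eq_iff, (metis diff_add_inverse le_add1)+)

lemma finite_pairs [simp]: "finite {(a, b). (\<lambda>v. a v + b v) = (m :: 'v::finite \<Rightarrow> nat)}"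
  by (rule finite_subset[of _ "{a. \<forall>v. a v \<le> m v} \<times> {a. \<forall>v. a v \<le> m v}"]) auto

lemmas finite_pairs' [simp] = finite_pairs[unfolded case_prod_unfold]

lemma mps_mult_commute: "mps_mult f g = mps_mult g f"
  by (rule ext, unfold mps_mult_pairs,
      rule sum.reindex_bij_witness[of _ "\<lambda>(a,b). (b,a)" "\<lambda>(a,b). (b,a)"]) (auto simp: add.commute)

lemma mps_mult_assoc: "mps_mult (mps_mult f g) h = mps_mult f (mps_mult g h)"
proof
  fix m
  have "mps_mult (mps_mult f g) h m =
    (\<Sum>(x, y)\<in>(SIGMA x:{(a, b). (\<lambda>v. a v + b v) = m}. {(c, d). (\<lambda>v. c v + d v) = fst x}).
       f (fst y) * g (snd y) * h (snd x))"
    by (subst sum.Sigma[symmetric]) (simp_all add: mps_mult_pairs sum_distrib_right case_prod_unfold)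
  also have "\<dots> = (\<Sum>(x, y)\<in>(SIGMA x:{(a, b). (\<lambda>v. a v + b v) = m}. {(c, d). (\<lambda>v. c v + d v) = snd x}).
       f (fst x) * (g (fst y) * h (snd y)))"
    by (rule sum.reindex_bij_witness[of _
          "\<lambda>((a,b),(c,d)). (((\<lambda>v. a v + c v), d), (a, c))"
          "\<lambda>((a,b),(c,d)). ((c, (\<lambda>v. d v + b v)), (d, b))"])
       (auto simp: fun_eq_iff, (metis add.assoc)+)
  also have "\<dots> = mps_mult f (mps_mult g h) m"
    by (subst sum.Sigma[symmetric]) (simp_all add: mps_mult_pairs sum_distrib_left case_prod_unfold)
  finally show "mps_mult (mps_mult f g) h m = mps_mult f (mps_mult g h) m" .
qed

lemma mps_mult_one: "mps_mult mps_one f = f"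
proof
  fix m
  have "mps_mult mps_one f m =
      (\<Sum>a\<in>{a. \<forall>v. a v \<le> m v}. if (\<lambda>_. 0) = a then f (\<lambda>v. m v - a v) else 0)"
    unfolding mps_mult_def mps_one_def by (rule sum.cong) auto
  thus "mps_mult mps_one f m = f m" by (simp add: sum.delta)
qed

instantiation mser :: (finite) comm_ring_1
begin
definition "1 = Ser mps_one"
definition "f * g = Ser (mps_mult (coeff f) (coeff g))"
instance
proof
  fix a b c :: "'a mser"
  show "a * b * c = a * (b * c)" by (simp add: times_mser_def mps_mult_assoc)
  show "a * b = b * a" by (simp add: times_mser_def mps_mult_commute)
  show "1 * a = a" by (simp add: times_mser_def one_mser_def mps_mult_one)
  show "(a + b) * c = a * c + b * c"
    by (rule mser_eqI) (simp add: times_mser_def mps_mult_def ring_distribs sum.distrib)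
  show "(0::'a mser) \<noteq> 1"
    by (auto simp: zero_mser_def one_mser_def mps_one_def fun_eq_iff)
qed
end

instance mser :: (finite) real_algebra_1
proof
  fix r :: real and f g :: "'a mser"
  show "r *\<^sub>R f * g = r *\<^sub>R (f * g)"
    by (rule mser_eqI) (simp add: times_mser_def mps_mult_def sum_distrib_left mult_ac)
  show "f * r *\<^sub>R g = r *\<^sub>R (f * g)"
    by (rule mser_eqI) (simp add: times_mser_def mps_mult_def sum_distrib_left mult_ac)
qed

lemma Ser_mult: "Ser (mps_mult f g) = Ser f * Ser g"
  by (simp add: times_mser_def)

lemma Ser_power: "Ser (mps_pow f n) = Ser f ^ n"
  by (induction n) (simp_all add: Ser_mult one_mser_def)

lemma Ser_smono:
  "length ks = length bs \<Longrightarrow> Ser (smono bs ks) = (\<Prod>i<length bs. Ser (bs ! i) ^ (ks ! i))"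
proof (induction bs ks rule: smono.induct)
  case (1 a as k ks)
  thus ?case
    by (simp add: Ser_mult Ser_power prod.lessThan_Suc_shift del: prod.lessThan_Suc)
qed (auto simp: one_mser_def)

section \<open>Linear vector fields as derivations\<close>

definition var :: "'v \<Rightarrow> 'v mser" where
  "var j = Ser (\<lambda>m. if m = (\<lambda>_. 0)(j := 1) then 1 else 0)"

definition pd :: "'v \<Rightarrow> 'v mser \<Rightarrow> 'v mser" where
  "pd i f = Ser (\<lambda>m. real (m i + 1) * coeff f (m(i := m i + 1)))"

definition DD :: "real^'v^'v \<Rightarrow> 'v::finite mser \<Rightarrow> 'v mser" where
  "DD A f = Ser (Dop A (coeff f))"

definition derivation :: "('r::real_algebra \<Rightarrow> 'r) \<Rightarrow> bool" where
  "derivation D \<longleftrightarrow> linear D \<and> (\<forall>f g. D (f * g) = D f * g + f * D g)"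

lemma coeff_var_mult:
  "coeff (var j * f) m = (if 0 < m j then coeff f (m(j := m j - 1)) else 0)"
proof -
  have "coeff (var j * f) m =
      (\<Sum>a\<in>{a. \<forall>v. a v \<le> m v}. if (\<lambda>_. 0)(j := 1) = a then coeff f (\<lambda>v. m v - a v) else 0)"
    unfolding times_mser_def coeff_Ser mps_mult_def var_def by (rule sum.cong) auto
  also have "\<dots> = (if \<forall>v. ((\<lambda>_. 0)(j := 1)) v \<le> m v
      then coeff f (\<lambda>v. m v - ((\<lambda>_. 0)(j := 1)) v) else 0)"
    by (simp add: sum.delta)
  also have "(\<lambda>v. m v - ((\<lambda>_. 0)(j := 1)) v) = m(j := m j - 1)"
    by auto
  also have "(\<forall>v. ((\<lambda>_. 0)(j := 1)) v \<le> m v) \<longleftrightarrow> 0 < m j"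
    by (auto simp: Suc_le_eq)
  finally show ?thesis .
qed

text \<open>Identifies the coefficient formula with the vector field having linear coefficients, so
  that later arguments work in the ring rather than with exponents.\<close>

lemma DD_eq: "DD A f = (\<Sum>i\<in>UNIV. \<Sum>j\<in>UNIV. A $ i $ j *\<^sub>R (var j * pd i f))"
  by (rule mser_eqI)
    (simp add: DD_def Dop_def coeff_sum coeff_var_mult pd_def Let_def if_distrib cong: if_cong)

lemma linear_pd: "linear (pd i)"
  by (rule linearI; rule mser_eqI) (simp_all add: pd_def algebra_simps)

lemma pd_commute: "pd i (pd k f) = pd k (pd i f)"
  by (rule mser_eqI) (auto simp: pd_def fun_upd_twist)

lemma pd_var: "pd i (var j) = (if i = j then 1 else 0)"
proof (rule mser_eqI)
  fix m :: "'a \<Rightarrow> nat"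
  show "coeff (pd i (var j)) m = coeff (if i = j then 1 else 0) m"
  proof (cases "i = j")
    case True
    have "m(i := m i + 1) = (\<lambda>_. 0)(j := 1) \<longleftrightarrow> m = (\<lambda>_. 0)"
      using True by (auto simp: fun_eq_iff)
    thus ?thesis using True
      by (auto simp: pd_def var_def one_mser_def mps_one_def)
  next
    case False
    hence "m(i := m i + 1) \<noteq> (\<lambda>_. 0)(j := 1)"
      by (auto dest: fun_cong[of _ _ i])
    thus ?thesis using False by (simp add: pd_def var_def)
  qed
qed

text \<open>In a product term for exponents \<open>a\<close> and \<open>b\<close> the factor
  \<open>m i + 1\<close> equals \<open>a i + b i\<close>; its two parts yield the two Leibniz
  terms.\<close>

lemma pd_mult: "pd i (f * g) = pd i f * g + f * pd i g"
proof (rule mser_eqI)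
  fix m :: "'a \<Rightarrow> nat"
  let ?m = "m(i := m i + 1)"
  let ?S = "\<lambda>n :: 'a \<Rightarrow> nat. {(a, b). (\<lambda>v. a v + b v) = n}"
  have "real (m i + 1) * (\<Sum>(a, b)\<in>?S ?m. coeff f a * coeff g b)
      = (\<Sum>(a, b)\<in>?S ?m. real (a i) * coeff f a * coeff g b)
        + (\<Sum>(a, b)\<in>?S ?m. real (b i) * coeff f a * coeff g b)"
    unfolding sum_distrib_left sum.distrib[symmetric]
  proof (rule sum.cong, safe, goal_cases)
    case (1 a b)
    hence "a i + b i = m i + 1" by (metis fun_upd_same)
    hence "real (m i + 1) = real (a i) + real (b i)" by linarith
    thus ?case by (simp only: ring_distribs mult.assoc)
  qed
  \<comment> \<open>Pairs with \<open>a i = 0\<close> contribute nothing; the others correspond to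
    the decompositions of \<open>m\<close> by lowering \<open>a\<close> at \<open>i\<close>.\<close>
  moreover have "(\<Sum>(a, b)\<in>?S ?m. real (a i) * coeff f a * coeff g b)
     = (\<Sum>(a, b)\<in>?S m. (real (a i + 1) * coeff f (a(i := a i + 1))) * coeff g b)"
    by (rule sum.mono_neutral_cong_right[THEN trans, of _ "{(a, b)\<in>?S ?m. 0 < a i}", OF _ _ _ refl],
        simp, blast, force,
        rule sum.reindex_bij_witness[of _ "\<lambda>(a,b). (a(i := a i + 1), b)" "\<lambda>(a,b). (a(i := a i - 1), b)"])
       (auto simp: fun_eq_iff)
  moreover have "(\<Sum>(a, b)\<in>?S ?m. real (b i) * coeff f a * coeff g b)
     = (\<Sum>(a, b)\<in>?S m. coeff f a * (real (b i + 1) * coeff g (b(i := b i + 1))))"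
    by (rule sum.mono_neutral_cong_right[THEN trans, of _ "{(a, b)\<in>?S ?m. 0 < b i}", OF _ _ _ refl],
        simp, blast, force,
        rule sum.reindex_bij_witness[of _ "\<lambda>(a,b). (a, b(i := b i + 1))" "\<lambda>(a,b). (a, b(i := b i - 1))"])
       (auto simp: fun_eq_iff split: if_splits)
  ultimately show "coeff (pd i (f * g)) m = coeff (pd i f * g + f * pd i g) m"
    by (simp add: pd_def times_mser_def mps_mult_pairs)
qed

lemma derivation_DD: "derivation (DD A)"
  unfolding derivation_def
proof (intro conjI allI linearI)
  fix f g
  show "DD A (f + g) = DD A f + DD A g"
    by (simp add: DD_eq linear_add[OF linear_pd] ring_distribs sum.distrib scaleR_add_right)
  show "DD A (f * g) = DD A f * g + f * DD A g"
    by (simp add: DD_eq pd_mult ring_distribs sum.distrib scaleR_add_right sum_distrib_left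
        sum_distrib_right mult_ac)
next
  fix c f
  show "DD A (c *\<^sub>R f) = c *\<^sub>R DD A f"
    by (simp add: DD_eq linear_scale[OF linear_pd] scaleR_sum_right mult_ac)
qed

lemma linear_DD [simp]: "linear (DD A)"
  using derivation_DD derivation_def by blast

lemmas DD_add = linear_add[OF linear_DD]
  and DD_diff = linear_diff[OF linear_DD]
  and DD_scaleR = linear_scale[OF linear_DD]
  and DD_sum = linear_sum[OF linear_DD]
  and DD_0 = linear_0[OF linear_DD]

lemma DD_mult: "DD A (f * g) = DD A f * g + f * DD A g"
  using derivation_DD derivation_def by blast

lemma DD_matrix_add: "DD (A + B) f = DD A f + DD B f"
  by (simp add: DD_eq scaleR_add_left sum.distrib)

lemma DD_matrix_diff: "DD (A - B) f = DD A f - DD B f"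
  by (simp add: DD_eq scaleR_diff_left sum_subtractf)

lemma DD_matrix_scaleR: "DD (c *\<^sub>R A) f = c *\<^sub>R DD A f"
  by (simp add: DD_eq scaleR_sum_right)

lemma DD_var: "DD A (var i) = (\<Sum>j\<in>UNIV. A $ i $ j *\<^sub>R var j)"
proof -
  have "DD A (var i) = (\<Sum>k\<in>UNIV. if i = k then (\<Sum>j\<in>UNIV. A $ k $ j *\<^sub>R var j) else 0)"
    unfolding DD_eq pd_var by (rule sum.cong) auto
  thus ?thesis by simp
qed

text \<open>\<open>Q A B\<close> is the second-order part of the composition. It is symmetric in
  \<open>A\<close> and \<open>B\<close> because partial derivatives commute, so only the first-order
  parts survive, and those multiply the matrices in reversed order.\<close>

lemma DD_DD_commutator: "DD A (DD B f) - DD B (DD A f) = DD (B ** A - A ** B) f"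
proof -
  define Q where "Q A B = (\<Sum>k\<in>UNIV. \<Sum>l\<in>UNIV. \<Sum>i\<in>UNIV. \<Sum>j\<in>UNIV.
      (B $ k $ l * A $ i $ j) *\<^sub>R (var l * (var j * pd i (pd k f))))" for A B :: "real^'a^'a"
  have Q: "Q A B = Q B A" for A B :: "real^'a^'a"
  proof -
    have "Q A B = (\<Sum>k\<in>UNIV. \<Sum>i\<in>UNIV. \<Sum>l\<in>UNIV. \<Sum>j\<in>UNIV.
      (B $ k $ l * A $ i $ j) *\<^sub>R (var l * (var j * pd i (pd k f))))"
      unfolding Q_def by (rule sum.cong[OF refl], rule sum.swap)
    also have "\<dots> = (\<Sum>i\<in>UNIV. \<Sum>k\<in>UNIV. \<Sum>l\<in>UNIV. \<Sum>j\<in>UNIV.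
      (B $ k $ l * A $ i $ j) *\<^sub>R (var l * (var j * pd i (pd k f))))"
      by (rule sum.swap)
    also have "\<dots> = (\<Sum>i\<in>UNIV. \<Sum>k\<in>UNIV. \<Sum>j\<in>UNIV. \<Sum>l\<in>UNIV.
      (B $ k $ l * A $ i $ j) *\<^sub>R (var l * (var j * pd i (pd k f))))"
      by (rule sum.cong[OF refl], rule sum.cong[OF refl], rule sum.swap)
    also have "\<dots> = (\<Sum>i\<in>UNIV. \<Sum>j\<in>UNIV. \<Sum>k\<in>UNIV. \<Sum>l\<in>UNIV.
      (B $ k $ l * A $ i $ j) *\<^sub>R (var l * (var j * pd i (pd k f))))"
      by (rule sum.cong[OF refl], rule sum.swap)
    also have "\<dots> = Q B A"
      unfolding Q_def by (intro sum.cong refl) (simp add: pd_commute mult_ac)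
    finally show ?thesis .
  qed
  have *: "DD A (DD B f) = DD (B ** A) f + Q A B" for A B :: "real^'a^'a"
  proof -
    have "DD A (DD B f) =
       (\<Sum>k\<in>UNIV. \<Sum>l\<in>UNIV. B $ k $ l *\<^sub>R (DD A (var l) * pd k f + var l * DD A (pd k f)))"
      by (subst (2) DD_eq) (simp add: DD_sum DD_scaleR DD_mult)
    also have "\<dots> = (\<Sum>k\<in>UNIV. \<Sum>l\<in>UNIV. \<Sum>j\<in>UNIV. (B $ k $ l * A $ l $ j) *\<^sub>R (var j * pd k f)) + Q A B"
      by (simp add: DD_var DD_eq[of A "pd k f" for k] Q_def scaleR_add_right sum.distrib
          sum_distrib_left sum_distrib_right scaleR_sum_right)
    also have "(\<Sum>k\<in>UNIV. \<Sum>l\<in>UNIV. \<Sum>j\<in>UNIV. (B $ k $ l * A $ l $ j) *\<^sub>R (var j * pd k f)) = DD (B ** A) f"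
      unfolding DD_eq
      by (rule sum.cong[OF refl], rule trans[OF sum.swap])
         (simp add: matrix_matrix_mult_def scaleR_sum_left)
    finally show ?thesis .
  qed
  show ?thesis using *[of A B] *[of B A] Q[of A B] by (simp add: DD_matrix_diff)
qed

lemma linear_funpow:
  fixes D :: "'r::real_vector \<Rightarrow> 'r"
  shows "linear D \<Longrightarrow> linear (D ^^ n)"
  by (induction n) (auto simp: linear_iff)

lemma derivation_linear: "derivation D \<Longrightarrow> linear D"
  and derivation_mult: "derivation D \<Longrightarrow> D (f * g) = D f * g + f * D g"
  by (simp_all add: derivation_def)

text \<open>Applying the Leibniz rule once per induction step on \<open>a + b\<close> replaces the
  binomial expansion of a power of \<open>D\<close>.\<close>

lemma derivation_power_mult_eq_0:
  fixes D :: "'r::real_algebra \<Rightarrow> 'r"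
  assumes "derivation D"
  shows "(D ^^ a) f = 0 \<Longrightarrow> (D ^^ b) g = 0 \<Longrightarrow> (D ^^ (a + b)) (f * g) = 0"
proof (induction "a + b" arbitrary: a b f g)
  case 0
  thus ?case by simp
next
  case (Suc n)
  note lin = linear_funpow[OF derivation_linear[OF assms]]
  show ?case
  \<comment> \<open>A zero exponent forces its factor to be 0; otherwise both exponents are
    successors and one \<open>D\<close> can be peeled off each.\<close>
  proof (cases "f = 0 \<or> g = 0")
    case True
    thus ?thesis using linear_0[OF lin] by auto
  next
    case False
    then obtain a' b' where ab: "a = Suc a'" "b = Suc b'"
      using Suc.prems by (cases a; cases b) auto
    have "(D ^^ (a' + b)) (D f * g) = 0" "(D ^^ (a + b')) (f * D g) = 0"
      using Suc.prems Suc.hyps(2) ab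
      by (intro Suc.hyps(1); simp add: funpow_swap1 del: funpow.simps(2) add: funpow_Suc_right)+
    hence "(D ^^ n) (D f * g) + (D ^^ n) (f * D g) = 0"
      using Suc.hyps(2) ab by (metis add.right_neutral add_Suc add_Suc_right diff_Suc_1)
    thus ?thesis
      using Suc.hyps(2)
      by (simp add: funpow_Suc_right derivation_mult[OF assms] linear_add[OF lin]
          del: funpow.simps(2) flip: Suc.hyps(2))
  qed
qed

text \<open>The leading term \<open>(D ^^ a) f\<close> with respect to the filtration by the kernels of the powers
  of a derivation is multiplicative up to a positive factor.\<close>

definition leads :: "('r::real_algebra \<Rightarrow> 'r) \<Rightarrow> nat \<Rightarrow> 'r \<Rightarrow> 'r \<Rightarrow> bool" where
  "leads D a f u \<longleftrightarrow> (\<exists>c>0. (D ^^ a) f = c *\<^sub>R u) \<and> D u = 0"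

text \<open>The actual factor is \<open>c * d\<close> times the binomial coefficient of
  \<open>a + b\<close> over \<open>a\<close>. The induction on \<open>a + b\<close> records only its
  sign.\<close>

lemma leads_mult:
  assumes "derivation D" "leads D a f u" "leads D b g v"
  shows "leads D (a + b) (f * g) (u * v)"
proof -
  note lin = linear_funpow[OF derivation_linear[OF assms(1)]]
  note lin1 = derivation_linear[OF assms(1)]
  have "\<exists>C>0. (D ^^ (a + b)) (f * g) = C *\<^sub>R (u * v)"
    if "(D ^^ a) f = c *\<^sub>R u" "(D ^^ b) g = d *\<^sub>R v" "c > 0" "d > 0" "D u = 0" "D v = 0"
    for c d
    using that
  proof (induction "a + b" arbitrary: a b f g)
    case 0
    thus ?case by (intro exI[of _ "c * d"]) auto
  next
    case (Suc n)
    \<comment> \<open>An exponent 0 makes its Leibniz term vanish, so each coefficient is only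
      nonnegative in general; since \<open>a + b > 0\<close>, at least one of the two is strictly
      positive.\<close>
    have left: "\<exists>C\<ge>0. (D ^^ n) (D f * g) = C *\<^sub>R (u * v) \<and> (0 < a \<longrightarrow> 0 < C)"
    proof (cases a)
      case 0
      hence "D f = 0" using Suc.prems by (simp add: linear_scale[OF lin1])
      thus ?thesis using 0 by (auto simp: linear_0[OF lin])
    next
      case (Suc a')
      thus ?thesis using Suc.hyps(1)[of a' b "D f" g] Suc.hyps(2) Suc.prems
        by (auto simp: funpow_Suc_right simp del: funpow.simps(2) intro: less_imp_le)
    qed
    have right: "\<exists>C\<ge>0. (D ^^ n) (f * D g) = C *\<^sub>R (u * v) \<and> (0 < b \<longrightarrow> 0 < C)"
    proof (cases b)
      case 0
      hence "D g = 0" using Suc.prems by (simp add: linear_scale[OF lin1])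
      thus ?thesis using 0 by (auto simp: linear_0[OF lin])
    next
      case (Suc b')
      thus ?thesis using Suc.hyps(1)[of a b' f "D g"] Suc.hyps(2) Suc.prems
        by (auto simp: funpow_Suc_right simp del: funpow.simps(2) intro: less_imp_le)
    qed
    from left right obtain C C' where
      C: "(D ^^ n) (D f * g) = C *\<^sub>R (u * v)" "(D ^^ n) (f * D g) = C' *\<^sub>R (u * v)"
        "C \<ge> 0" "C' \<ge> 0" "0 < a \<longrightarrow> 0 < C" "0 < b \<longrightarrow> 0 < C'" by blast
    have "C + C' > 0" using C Suc.hyps(2) by (cases a; cases b) auto
    moreover have "(D ^^ (a + b)) (f * g) = (C + C') *\<^sub>R (u * v)"
      using C by (simp add: funpow_Suc_right derivation_mult[OF assms(1)] linear_add[OF lin]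
          scaleR_add_left del: funpow.simps(2) flip: Suc.hyps(2))
    ultimately show ?case by blast
  qed
  thus ?thesis
    using assms(2,3) derivation_mult[OF assms(1)] by (auto simp: leads_def)
qed

lemma derivation_1:
  fixes D :: "'r::real_algebra_1 \<Rightarrow> 'r"
  assumes "derivation D" shows "D 1 = 0"
  using derivation_mult[OF assms, of 1 1] by simp

lemma leads_prod_list:
  fixes D :: "'r::real_algebra_1 \<Rightarrow> 'r"
  assumes "derivation D" "\<And>x. x \<in> set xs \<Longrightarrow> leads D (a x) (f x) (u x)"
  shows "leads D (sum_list (map a xs)) (prod_list (map f xs)) (prod_list (map u xs))"
  using assms(2)
proof (induction xs)
  case Nil
  show ?case by (auto simp: leads_def derivation_1[OF assms(1)] intro: exI[of _ 1])
qed (auto intro: leads_mult[OF assms(1)])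

section \<open>Gradings\<close>

text \<open>One notion serves three gradings: constant weight 1 gives the total degree, the
  indicator of one group of variables gives the degree in that group.\<close>

definition wt :: "('v::finite \<Rightarrow> nat) \<Rightarrow> ('v \<Rightarrow> nat) \<Rightarrow> nat" where
  "wt w m = (\<Sum>v\<in>UNIV. w v * m v)"

definition wdeg :: "('v::finite \<Rightarrow> nat) \<Rightarrow> nat \<Rightarrow> 'v mser \<Rightarrow> bool" where
  "wdeg w d f \<longleftrightarrow> (\<forall>m. coeff f m \<noteq> 0 \<longrightarrow> wt w m = d)"

definition trunc :: "('v::finite \<Rightarrow> nat) \<Rightarrow> nat \<Rightarrow> 'v mser \<Rightarrow> 'v mser" where
  "trunc w d f = Ser (\<lambda>m. if wt w m = d then coeff f m else 0)"

text \<open>Stated with a term added on both sides because subtraction of naturals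
  truncates.\<close>

lemma wt_upd: "wt w (m(i := k)) + w i * m i = wt w m + w i * k"
proof -
  have "wt w (m(i := k)) = w i * k + (\<Sum>v\<in>UNIV - {i}. w v * m v)"
    "wt w m = w i * m i + (\<Sum>v\<in>UNIV - {i}. w v * m v)"
    unfolding wt_def by (subst sum.remove[of _ i]; auto intro!: sum.cong)+
  thus ?thesis by simp
qed

lemma wt_add: "wt w (\<lambda>v. a v + b v) = wt w a + wt w b"
  by (simp add: wt_def ring_distribs sum.distrib)

lemma wdeg_trunc [simp]: "wdeg w d (trunc w d f)"
  by (simp add: wdeg_def trunc_def)

lemma wdeg_iff_trunc: "wdeg w d f \<longleftrightarrow> trunc w d f = f"
proof
  assume "wdeg w d f"
  thus "trunc w d f = f" by (intro mser_eqI) (auto simp: wdeg_def trunc_def)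
qed (metis wdeg_trunc)

lemma trunc_commute: "trunc w d (trunc w' d' f) = trunc w' d' (trunc w d f)"
  by (auto simp: trunc_def)

lemma wdeg_0 [simp]: "wdeg w d 0"
  and wdeg_add: "wdeg w d f \<Longrightarrow> wdeg w d g \<Longrightarrow> wdeg w d (f + g)"
  and wdeg_diff: "wdeg w d f \<Longrightarrow> wdeg w d g \<Longrightarrow> wdeg w d (f - g)"
  and wdeg_scaleR: "wdeg w d f \<Longrightarrow> wdeg w d (c *\<^sub>R f)"
  and wdeg_1: "wdeg w 0 1"
     apply (auto simp: wdeg_def)
    apply (metis add.left_neutral)
   apply (metis diff_0_right)
  apply (auto simp: one_mser_def mps_one_def wt_def split: if_splits)
  done

lemma wdeg_mult:
  assumes "wdeg w d f" "wdeg w e g"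
  shows "wdeg w (d + e) (f * g)"
  unfolding wdeg_def
proof (intro allI impI)
  fix m
  assume "coeff (f * g) m \<noteq> 0"
  then obtain a b where "(\<lambda>v. a v + b v) = m" "coeff f a * coeff g b \<noteq> 0"
    unfolding times_mser_def coeff_Ser mps_mult_pairs
    by (smt (verit) case_prodE mem_Collect_eq sum.neutral case_prod_conv)
  thus "wt w m = d + e" using assms by (auto simp: wdeg_def wt_add)
qed

lemma wdeg_power: "wdeg w d f \<Longrightarrow> wdeg w (n * d) (f ^ n)"
  by (induction n) (auto intro: wdeg_mult wdeg_1)

lemma wdeg_prod:
  "(\<And>i. i \<in> I \<Longrightarrow> wdeg w (d i) (f i)) \<Longrightarrow> wdeg w (sum d I) (prod f I)"
  by (induction I rule: infinite_finite_induct) (auto intro: wdeg_mult wdeg_1)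

lemma wdeg_sum: "(\<And>i. i \<in> I \<Longrightarrow> wdeg w d (f i)) \<Longrightarrow> wdeg w d (sum f I)"
  by (induction I rule: infinite_finite_induct) (auto intro: wdeg_add)

text \<open>Each term of the field trades one variable for another of equal weight, so it respects
  the grading and commutes with projection to a component.\<close>

lemma DD_trunc:
  assumes "\<And>i j. A $ i $ j \<noteq> 0 \<Longrightarrow> w i = w j"
  shows "DD A (trunc w d f) = trunc w d (DD A f)"
proof (rule mser_eqI)
  fix m
  have *: "wt w ((m(j := m j - 1))(i := (m(j := m j - 1)) i + 1)) = wt w m"
    if "0 < m j" "A $ i $ j \<noteq> 0" for i j
  proof -
    let ?n = "m(j := m j - 1)"
    have "wt w ?n + w j * m j = wt w m + w j * (m j - 1)"
      using wt_upd[of w m j "m j - 1"] by simp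
    hence "wt w ?n + w j = wt w m"
      using that(1) by (cases "m j") auto
    moreover have "wt w (?n(i := ?n i + 1)) + w i * ?n i = wt w ?n + w i * (?n i + 1)"
      by (rule wt_upd)
    ultimately show ?thesis using assms[OF that(2)] by (simp del: fun_upd_apply)
  qed
  show "coeff (DD A (trunc w d f)) m = coeff (trunc w d (DD A f)) m"
  proof (cases "wt w m = d")
    case True
    thus ?thesis
      unfolding DD_def trunc_def Dop_def coeff_Ser Let_def
      using * by (intro trans[OF sum.cong[OF refl sum.cong[OF refl]] if_P[symmetric]])
         (auto simp del: fun_upd_apply)
  next
    case False
    thus ?thesis
      unfolding DD_def trunc_def Dop_def coeff_Ser Let_def
      using * by (intro trans[OF sum.neutral if_not_P[symmetric]] ballI sum.neutral)
         (auto simp del: fun_upd_apply, metis)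
  qed
qed

lemma wdeg_DD:
  assumes "\<And>i j. A $ i $ j \<noteq> 0 \<Longrightarrow> w i = w j" "wdeg w d f"
  shows "wdeg w d (DD A f)"
  using DD_trunc[of A w d f] assms by (metis wdeg_iff_trunc)

lemma wdeg_pow_DD:
  assumes "\<And>i j. A $ i $ j \<noteq> 0 \<Longrightarrow> w i = w j" "wdeg w d f"
  shows "wdeg w d ((DD A ^^ n) f)"
  by (induction n) (auto intro: assms wdeg_DD)

section \<open>Local nilpotency\<close>

lemma matrix_mult_linear:
  fixes A B C :: "real^'n^'n"
  shows "A ** (B + C) = A ** B + A ** C" "(A + B) ** C = A ** C + B ** C"
    "A ** (B - C) = A ** B - A ** C" "(A - B) ** C = A ** C - B ** C"
    "A ** (c *\<^sub>R B) = c *\<^sub>R (A ** B)" "(c *\<^sub>R A) ** B = c *\<^sub>R (A ** B)"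
  by (simp_all add: vec_eq_iff matrix_matrix_mult_def ring_distribs sum.distrib sum_subtractf
      sum_distrib_left mult_ac)

text \<open>The powers of \<open>Y\<close> are eigenvectors of the bounded operator \<open>M \<mapsto> Z M - M Z\<close> with unbounded
  eigenvalues, so almost all of them vanish.\<close>

lemma sl2_lower_nilpotent:
  fixes Y Z :: "real^'n^'n"
  assumes "Z ** Y - Y ** Z = - (2 *\<^sub>R Y)"
  shows "\<exists>N. ((\<lambda>M. M ** Y) ^^ N) (mat 1) = 0"
proof -
  define P where "P n = ((\<lambda>M. M ** Y) ^^ n) (mat 1)" for n
  have "linear (\<lambda>M :: real^'n^'n. Z ** M - M ** Z)"
    by (rule linearI) (simp_all add: matrix_mult_linear scaleR_diff_right)
  then obtain B where B: "\<And>M :: real^'n^'n. norm (Z ** M - M ** Z) \<le> B * norm M"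
    using linear_bounded by blast
  have comm: "Z ** P n - P n ** Z = - (2 * real n) *\<^sub>R P n" for n
  proof (induction n)
    case 0
    show ?case by (simp add: P_def)
  next
    case (Suc n)
    have "P (Suc n) = P n ** Y" by (simp add: P_def)
    hence "Z ** P (Suc n) - P (Suc n) ** Z = (Z ** P n - P n ** Z) ** Y + P n ** (Z ** Y - Y ** Z)"
      by (simp add: matrix_mult_linear matrix_mul_assoc)
    also have "\<dots> = (- (2 * real n) *\<^sub>R P n) ** Y + P n ** ((-2) *\<^sub>R Y)"
      using Suc assms by simp
    also have "\<dots> = - (2 * real (Suc n)) *\<^sub>R (P n ** Y)"
      by (simp only: matrix_mult_linear) (simp add: algebra_simps flip: scaleR_add_left)
    finally show ?case by (simp add: P_def)
  qed
  obtain n where n: "real n > B" using reals_Archimedean2 by blast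
  have "2 * real n * norm (P n) \<le> B * norm (P n)"
    using B[of "P n"] by (simp add: comm)
  hence "P n = 0"
    using n by (smt (verit) mult_right_less_imp_less mult_strict_right_mono norm_ge_zero
        norm_eq_zero of_nat_0_le_iff)
  thus ?thesis unfolding P_def by blast
qed

text \<open>Row \<open>i\<close> of the matrix power \<open>Y^n\<close>: nilpotency of the matrix
  thus becomes nilpotency of the derivation on the variables.\<close>

lemma DD_pow_var:
  "(DD Y ^^ n) (var i) = (\<Sum>j\<in>UNIV. ((\<lambda>M. M ** Y) ^^ n) (mat 1) $ i $ j *\<^sub>R var j)"
proof (induction n)
  case 0
  have "(\<Sum>j\<in>UNIV. (mat 1 :: real^'a^'a) $ i $ j *\<^sub>R var j) = (\<Sum>j\<in>UNIV. if i = j then var j else 0)"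
    by (rule sum.cong) (auto simp: mat_def)
  thus ?case by simp
next
  case (Suc n)
  have "(DD Y ^^ Suc n) (var i) = (\<Sum>j\<in>UNIV. \<Sum>k\<in>UNIV.
     (((\<lambda>M. M ** Y) ^^ n) (mat 1) $ i $ j * Y $ j $ k) *\<^sub>R var k)"
    by (simp add: Suc DD_sum DD_scaleR DD_var scaleR_sum_right)
  also have "\<dots> = (\<Sum>k\<in>UNIV. \<Sum>j\<in>UNIV.
     (((\<lambda>M. M ** Y) ^^ n) (mat 1) $ i $ j * Y $ j $ k) *\<^sub>R var k)"
    by (rule sum.swap)
  finally show ?case by (simp add: matrix_matrix_mult_def scaleR_sum_left)
qed

lemma euler: "wdeg (\<lambda>_. 1) d f \<Longrightarrow> real d *\<^sub>R f = (\<Sum>j\<in>UNIV. var j * pd j f)"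
proof (rule mser_eqI)
  fix m assume f: "wdeg (\<lambda>_. 1) d f"
  have "coeff (\<Sum>j\<in>UNIV. var j * pd j f) m = (\<Sum>j\<in>UNIV. real (m j) * coeff f m)"
    unfolding coeff_sum coeff_var_mult pd_def by (rule sum.cong) auto
  also have "\<dots> = real d * coeff f m"
    using f by (cases "coeff f m = 0") (auto simp: wdeg_def wt_def simp flip: sum_distrib_right)
  finally show "coeff (real d *\<^sub>R f) m = coeff (\<Sum>j\<in>UNIV. var j * pd j f) m" by simp
qed

lemma wdeg_pd: "wdeg (\<lambda>_. 1) (Suc d) f \<Longrightarrow> wdeg (\<lambda>_. 1) d (pd j f)"
proof (unfold wdeg_def, intro allI impI)
  fix m
  assume f: "\<forall>m. coeff f m \<noteq> 0 \<longrightarrow> wt (\<lambda>_. 1) m = Suc d" and "coeff (pd j f) m \<noteq> 0"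
  hence "wt (\<lambda>_. 1) (m(j := m j + 1)) = Suc d" by (simp add: pd_def)
  thus "wt (\<lambda>_. 1) m = d" using wt_upd[of "\<lambda>_. 1" m j "m j + 1"] by simp
qed

text \<open>Euler's identity writes \<open>(d + 1) f\<close> as the sum of the products
  \<open>var j * pd j f\<close>. Some power kills all variables, another kills everything of degree
  \<open>d\<close>, and the sum of the two exponents kills the products. The exponent depends on the
  degree only, not on \<open>f\<close>.\<close>

lemma DD_locally_nilpotent:
  fixes Y Z :: "real^'n^'n"
  assumes "Z ** Y - Y ** Z = - (2 *\<^sub>R Y)"
  shows "\<exists>N. \<forall>f. wdeg (\<lambda>_. 1) d f \<longrightarrow> (DD Y ^^ N) f = 0"
proof (induction d)
  case 0
  have "DD Y f = 0" if "wdeg (\<lambda>_. 1) 0 f" for f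
  proof -
    have "pd i f = 0" for i
    proof (rule mser_eqI)
      fix m
      have "wt (\<lambda>_. 1) (m(i := m i + 1)) \<noteq> 0"
        unfolding wt_def by (auto intro!: exI[of _ i])
      hence "coeff f (m(i := m i + 1)) = 0" using that unfolding wdeg_def by metis
      thus "coeff (pd i f) m = coeff 0 m" by (simp add: pd_def)
    qed
    thus ?thesis by (simp add: DD_eq)
  qed
  thus ?case by (intro exI[of _ 1]) simp
next
  case (Suc d)
  then obtain N where N: "\<And>f. wdeg (\<lambda>_. 1) d f \<Longrightarrow> (DD Y ^^ N) f = 0" by blast
  obtain K where K: "((\<lambda>M. M ** Y) ^^ K) (mat 1) = 0"
    using sl2_lower_nilpotent[OF assms] by blast
  note lin = linear_funpow[OF linear_DD[of Y], of "K + N"]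
  have "(DD Y ^^ (K + N)) f = 0" if f: "wdeg (\<lambda>_. 1) (Suc d) f" for f
  proof -
    have "(DD Y ^^ (K + N)) (var j * pd j f) = 0" for j
      by (rule derivation_power_mult_eq_0[OF derivation_DD])
        (simp_all only: DD_pow_var K N[OF wdeg_pd[OF f]], simp)
    hence "real (Suc d) *\<^sub>R (DD Y ^^ (K + N)) f = 0"
      by (subst linear_scale[OF lin, symmetric]) (simp only: euler[OF f] linear_sum[OF lin], simp)
    thus ?thesis by simp
  qed
  thus ?case by blast
qed

section \<open>Operators forming an sl(2) triad\<close>

locale sl2_ops =
  fixes x y z :: "'r::real_vector \<Rightarrow> 'r"
  assumes lin: "linear x" "linear y" "linear z"
    and xy: "x (y v) = y (x v) + z v"
    and zx: "z (x v) = x (z v) + 2 *\<^sub>R x v"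
    and zy: "z (y v) = y (z v) - 2 *\<^sub>R y v"
begin

lemmas ops_simps =
  linear_add[OF lin(1)] linear_add[OF lin(2)] linear_add[OF lin(3)]
  linear_diff[OF lin(1)] linear_diff[OF lin(2)] linear_diff[OF lin(3)]
  linear_scale[OF lin(1)] linear_scale[OF lin(2)] linear_scale[OF lin(3)]

lemma weight_lower_power:
  "z u = \<mu> *\<^sub>R u \<Longrightarrow> z ((y ^^ j) u) = (\<mu> - 2 * real j) *\<^sub>R (y ^^ j) u"
proof (induction j)
  case (Suc j)
  have "z ((y ^^ Suc j) u) = y (z ((y ^^ j) u)) - 2 *\<^sub>R (y ^^ Suc j) u"
    by (simp add: zy)
  also have "\<dots> = ((\<mu> - 2 * real j) - 2) *\<^sub>R (y ^^ Suc j) u"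
    by (simp only: Suc.IH[OF Suc.prems] ops_simps scaleR_diff_left) simp
  finally show ?case by (simp add: algebra_simps)
qed simp

text \<open>The factor is the sum of the weights \<open>\<mu> - 2 i\<close> for
  \<open>i = 0, ..., j\<close> picked up while \<open>x\<close> moves past each
  \<open>y\<close>.\<close>

lemma raise_lower_power:
  assumes "x u = 0" "z u = \<mu> *\<^sub>R u"
  shows "x ((y ^^ Suc j) u) = ((real j + 1) * (\<mu> - real j)) *\<^sub>R (y ^^ j) u"
proof (induction j)
  case 0
  show ?case using assms linear_0[OF lin(2)] by (simp add: xy)
next
  case (Suc j)
  have "x ((y ^^ Suc (Suc j)) u) = y (x ((y ^^ Suc j) u)) + z ((y ^^ Suc j) u)"
    by (simp add: xy)
  also have "\<dots> = ((real j + 1) * (\<mu> - real j) + (\<mu> - 2 * real (Suc j))) *\<^sub>R (y ^^ Suc j) u"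
    by (simp only: Suc weight_lower_power[OF assms(2)] ops_simps scaleR_add_left) simp
  also have "(real j + 1) * (\<mu> - real j) + (\<mu> - 2 * real (Suc j))
      = (real (Suc j) + 1) * (\<mu> - real (Suc j))"
    by (simp add: algebra_simps)
  finally show ?case .
qed

text \<open>The constant is the product of \<open>(i + 1) (\<mu> - i)\<close> over
  \<open>i < j\<close>, positive as long as \<open>j\<close> does not exceed the weight.\<close>

lemma raise_power_lower_power:
  assumes "x u = 0" "z u = \<mu> *\<^sub>R u"
  shows "real j \<le> \<mu> \<Longrightarrow> \<exists>c>0. (x ^^ j) ((y ^^ j) u) = c *\<^sub>R u"
proof (induction j)
  case (Suc j)
  then obtain c where "c > 0" "(x ^^ j) ((y ^^ j) u) = c *\<^sub>R u" by auto
  moreover have "(x ^^ Suc j) ((y ^^ Suc j) u)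
      = ((real j + 1) * (\<mu> - real j)) *\<^sub>R (x ^^ j) ((y ^^ j) u)"
    by (simp only: funpow_Suc_right[of j x] o_apply raise_lower_power[OF assms]
        linear_scale[OF linear_funpow[OF lin(1)]])
  ultimately show ?case
    using Suc.prems by (intro exI[of _ "(real j + 1) * (\<mu> - real j) * c"]) auto
qed (auto intro: exI[of _ 1])

text \<open>The classical identity \<open>[x^n, y] = n (z - (n - 1)) x^(n-1)\<close> for
  \<open>n = Suc j\<close>, applied to an arbitrary vector rather than a weight vector.\<close>

lemma raise_power_lower:
  "(x ^^ Suc j) (y h) = y ((x ^^ Suc j) h) + real (Suc j) *\<^sub>R (z ((x ^^ j) h) - real j *\<^sub>R (x ^^ j) h)"
proof (induction j)
  case 0
  show ?case by (simp add: xy)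
next
  case (Suc j)
  let ?w = "(x ^^ Suc j) h"
  have arith: "a *\<^sub>R (A - 2 *\<^sub>R w - (a - 1) *\<^sub>R w) + (B + A) = B + (a + 1) *\<^sub>R (A - a *\<^sub>R w)"
    for a :: real and A B w :: 'r
  proof -
    have "a *\<^sub>R (A - 2 *\<^sub>R w - (a - 1) *\<^sub>R w) = a *\<^sub>R A - (a * 2 + a * (a - 1)) *\<^sub>R w"
      by (simp add: scaleR_diff_right scaleR_add_left)
    also have "a * 2 + a * (a - 1) = (a + 1) * a" by (simp add: algebra_simps)
    finally show ?thesis by (simp add: scaleR_diff_right scaleR_add_left)
  qed
  have xz: "x (z ((x ^^ j) h)) = z ?w - 2 *\<^sub>R ?w"
    using zx[of "(x ^^ j) h"] by simp
  have "(x ^^ Suc (Suc j)) (y h) = x (y ?w)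
      + real (Suc j) *\<^sub>R (x (z ((x ^^ j) h)) - real j *\<^sub>R ?w)"
    using Suc by (simp add: ops_simps)
  also have "\<dots> = real (Suc j) *\<^sub>R (z ?w - 2 *\<^sub>R ?w - (real (Suc j) - 1) *\<^sub>R ?w) + (y (x ?w) + z ?w)"
    unfolding xz by (simp add: xy)
  also have "\<dots> = y (x ?w) + (real (Suc j) + 1) *\<^sub>R (z ?w - real (Suc j) *\<^sub>R ?w)"
    by (rule arith)
  finally show ?case by (simp add: add.commute)
qed

text \<open>If \<open>x ((x ^^ s) h) = 0\<close> then \<open>(z - s) ((x ^^ s) h)\<close> is again in the kernel of \<open>x\<close> and in the
  image of \<open>x ^^ Suc s\<close>. As \<open>x\<close> is nilpotent on \<open>S\<close>, iterating this kills the vector, so all of its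
  weights are at least \<open>s\<close>.\<close>

lemma weights_ge:
  assumes S: "\<And>h. h \<in> S \<Longrightarrow> y h \<in> S" "\<And>c h. h \<in> S \<Longrightarrow> c *\<^sub>R h \<in> S"
    and nil: "\<And>h. h \<in> S \<Longrightarrow> (x ^^ N) h = 0"
    and v: "\<And>i. i \<in> I \<Longrightarrow> z (v i) = \<rho> i *\<^sub>R v i"
    and indep: "\<And>c i. (\<Sum>i\<in>I. c i *\<^sub>R v i) = 0 \<Longrightarrow> i \<in> I \<Longrightarrow> c i = 0"
  shows "h \<in> S \<Longrightarrow> x ((x ^^ s) h) = 0 \<Longrightarrow> (x ^^ s) h = (\<Sum>i\<in>I. c i *\<^sub>R v i) \<Longrightarrow>
    i \<in> I \<Longrightarrow> c i \<noteq> 0 \<Longrightarrow> real s \<le> \<rho> i"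
proof (induction "N - s" arbitrary: s h c)
  case 0
  then obtain r where "s = r + N" by (metis diff_is_0_eq le_add_diff_inverse2)
  hence "(x ^^ s) h = (x ^^ r) 0"
    using nil[OF \<open>h \<in> S\<close>] by (simp add: funpow_add)
  hence "(x ^^ s) h = 0" by (simp add: linear_0[OF linear_funpow[OF lin(1)]])
  with 0 indep show ?case by metis
next
  case (Suc n)
  \<comment> \<open>Scaled so that \<open>x ^^ Suc s\<close> sends it exactly to
    \<open>(z - s) ((x ^^ s) h)\<close>.\<close>
  let ?h = "(1 / real (Suc s)) *\<^sub>R y h"
  have "(x ^^ Suc s) (y h) = real (Suc s) *\<^sub>R (z ((x ^^ s) h) - real s *\<^sub>R (x ^^ s) h)"
    unfolding raise_power_lower using Suc.prems(2) by (simp add: linear_0[OF lin(2)])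
  hence eq: "(x ^^ Suc s) ?h = z ((x ^^ s) h) - real s *\<^sub>R (x ^^ s) h"
    by (simp only: linear_scale[OF linear_funpow[OF lin(1)]]) simp
  have sum: "(x ^^ Suc s) ?h = (\<Sum>i\<in>I. ((\<rho> i - real s) * c i) *\<^sub>R v i)"
    unfolding eq Suc.prems(3)
    by (simp add: linear_sum[OF lin(3)] ops_simps v scaleR_sum_right sum_subtractf algebra_simps
        cong: sum.cong)
  have "x (z ((x ^^ s) h)) = 0"
    using zx[of "(x ^^ s) h"] Suc.prems(2) by (simp add: linear_0[OF lin(3)])
  hence "x ((x ^^ Suc s) ?h) = 0"
    unfolding eq using Suc.prems(2) by (simp add: ops_simps)
  hence "(\<rho> i - real s) * c i \<noteq> 0 \<Longrightarrow> real (Suc s) \<le> \<rho> i"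
    using Suc.hyps Suc.prems S sum by (intro Suc.hyps(1)[of "Suc s" ?h "\<lambda>i. (\<rho> i - real s) * c i"]) auto
  \<comment> \<open>Applying \<open>z - s\<close> multiplies the \<open>i\<close>-th coefficient by
    \<open>\<rho> i - s\<close>: either this is 0 and the bound holds with equality, or the
    coefficient survives and induction gives the stronger bound.\<close>
  thus ?case using Suc.prems(5) by (cases "\<rho> i = real s") auto
qed

end

text \<open>Because \<open>DD\<close> reverses commutators, a matrix triad yields an operator triad
  once \<open>X\<close> and \<open>Y\<close> trade places: \<open>DD Y\<close> raises and
  \<open>DD X\<close> lowers.\<close>

lemma sl2_ops_DD:
  assumes "sl2_triad X Y Z"
  shows "sl2_ops (DD Y) (DD X) (DD Z)"
proof
  have XY: "X ** Y - Y ** X = Z" and ZX: "Z ** X - X ** Z = 2 *\<^sub>R X"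
    and ZY: "Z ** Y - Y ** Z = - (2 *\<^sub>R Y)"
    using assms by (auto simp: sl2_triad_def)
  fix v
  show "DD Y (DD X v) = DD X (DD Y v) + DD Z v"
    using DD_DD_commutator[of Y X v] XY by (simp add: algebra_simps)
  have "DD Z (DD Y v) - DD Y (DD Z v) = DD (2 *\<^sub>R Y) v"
    using DD_DD_commutator[of Z Y v] ZY by (metis minus_diff_eq minus_minus)
  thus "DD Z (DD Y v) = DD Y (DD Z v) + 2 *\<^sub>R DD Y v"
    by (simp add: DD_matrix_scaleR algebra_simps)
  have "DD Z (DD X v) - DD X (DD Z v) = DD ((-2) *\<^sub>R X) v"
    using DD_DD_commutator[of Z X v] ZX by (metis minus_diff_eq scaleR_minus_left)
  thus "DD Z (DD X v) = DD X (DD Z v) - 2 *\<^sub>R DD X v"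
    unfolding DD_matrix_scaleR by (simp add: algebra_simps)
qed (simp_all add: DD_add DD_scaleR linear_DD)

section \<open>Transvectants\<close>

locale two_sl2 =
  p: sl2_ops x1 y1 z1 + q: sl2_ops x2 y2 z2
  for x1 y1 z1 x2 y2 z2 :: "'r::{comm_ring_1,real_algebra_1} \<Rightarrow> 'r" +
  assumes der: "derivation x1" "derivation x2" "derivation z1" "derivation z2"
begin

definition tvt :: "int \<Rightarrow> int \<Rightarrow> nat \<Rightarrow> 'r \<Rightarrow> 'r \<Rightarrow> 'r" where
  "tvt \<mu> \<nu> s f g = (\<Sum>j\<le>s. ((-1) ^ j *
      (real (s choose j) * fact (nat (\<mu> - int j)) / fact (nat (\<mu> - int s))
        * fact (nat (\<nu> - int s + int j)) / fact (nat (\<nu> - int s))))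
      *\<^sub>R ((y1 ^^ j) f * (y2 ^^ (s - j)) g))"

text \<open>The third and fourth assumptions on \<open>f\<close> and on \<open>g\<close> express,
  without mentioning variables, that \<open>f\<close> involves only the first group of variables and
  \<open>g\<close> only the second.\<close>

context
  fixes f g :: 'r and \<mu> \<nu> :: int and s :: nat
  assumes f: "x1 f = 0" "z1 f = of_int \<mu> *\<^sub>R f" "\<And>j. x2 ((y1 ^^ j) f) = 0" "\<And>j. z2 ((y1 ^^ j) f) = 0"
    and g: "x2 g = 0" "z2 g = of_int \<nu> *\<^sub>R g" "\<And>j. x1 ((y2 ^^ j) g) = 0" "\<And>j. z1 ((y2 ^^ j) g) = 0"
    and s: "int s \<le> \<mu>" "int s \<le> \<nu>"
begin

lemma lin12: "linear x1" "linear x2" "linear z1" "linear z2"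
  by (simp_all add: p.lin q.lin)

lemma tvt_weight:
  "z1 (tvt \<mu> \<nu> s f g) + z2 (tvt \<mu> \<nu> s f g) = of_int (\<mu> + \<nu> - 2 * int s) *\<^sub>R tvt \<mu> \<nu> s f g"
proof -
  have *: "z1 ((y1 ^^ j) f * (y2 ^^ (s - j)) g) + z2 ((y1 ^^ j) f * (y2 ^^ (s - j)) g)
      = of_int (\<mu> + \<nu> - 2 * int s) *\<^sub>R ((y1 ^^ j) f * (y2 ^^ (s - j)) g)" if "j \<le> s" for j
    using that
    by (simp add: der[THEN derivation_mult] f g p.weight_lower_power[OF f(2)]
        q.weight_lower_power[OF g(2)] of_nat_diff algebra_simps flip: scaleR_add_left)
  show ?thesis
    unfolding tvt_def linear_sum[OF lin12(3)] linear_sum[OF lin12(4)] sum.distrib[symmetric]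
      scaleR_sum_right
  proof (rule sum.cong[OF refl])
    fix j assume j: "j \<in> {..s}"
    have "z1 (c *\<^sub>R v) + z2 (c *\<^sub>R v) = c *\<^sub>R (z1 v + z2 v)" for c v
      by (simp add: linear_scale[OF lin12(3)] linear_scale[OF lin12(4)] scaleR_add_right)
    thus "z1 (c *\<^sub>R ((y1 ^^ j) f * (y2 ^^ (s - j)) g)) + z2 (c *\<^sub>R ((y1 ^^ j) f * (y2 ^^ (s - j)) g))
        = of_int (\<mu> + \<nu> - 2 * int s) *\<^sub>R c *\<^sub>R ((y1 ^^ j) f * (y2 ^^ (s - j)) g)" for c
      using *[of j] j by (simp add: mult.commute)
  qed
qed

text \<open>\<open>x1\<close> of summand \<open>j + 1\<close> and \<open>x2\<close> of summand
  \<open>j\<close> are multiples of the same product, and the recursion satisfied by the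
  transvectant coefficients makes them cancel. At the ends, \<open>x1\<close> kills summand 0 and
  \<open>x2\<close> kills summand \<open>s\<close>.\<close>

lemma tvt_kernel: "x1 (tvt \<mu> \<nu> s f g) + x2 (tvt \<mu> \<nu> s f g) = 0"
proof -
  define W where "W j = (-1) ^ j *
      (real (s choose j) * fact (nat (\<mu> - int j)) / fact (nat (\<mu> - int s))
        * fact (nat (\<nu> - int s + int j)) / fact (nat (\<nu> - int s)))" for j
  have W: "W (Suc j) * ((real j + 1) * (of_int \<mu> - real j))
      = - (W j * ((real (s - Suc j) + 1) * (of_int \<nu> - real (s - Suc j))))" if "j < s" for j
  proof -
    \<comment> \<open>Natural slacks \<open>a\<close> and \<open>b\<close> turn all arguments of
      \<open>nat\<close> into sums of naturals, so that the factorials unfold.\<close>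
    have "int (Suc j) \<le> \<mu>" using s that by linarith
    then obtain a where a: "\<mu> = int (Suc j) + int a" using zle_iff_zadd by blast
    obtain b where b: "\<nu> = int s + int b" using s zle_iff_zadd by blast
    have e: "nat (\<mu> - int j) = Suc a" "nat (\<mu> - int (Suc j)) = a"
      "nat (\<nu> - int s + int (Suc j)) = Suc (b + j)" "nat (\<nu> - int s + int j) = b + j"
      using a b by auto
    have "Suc j * (s choose Suc j) = (s - j) * (s choose j)"
      by (simp only: binomial_absorption binomial_absorb_comp)
    hence "real (Suc j * (s choose Suc j)) = real ((s - j) * (s choose j))"
      by (simp only:)
    hence c: "real (s choose Suc j) * (real j + 1) = real (s choose j) * real (s - j)"
      by (simp only: of_nat_mult of_nat_Suc) (simp only: mult_ac add.commute)
    define F where "F = fact a / fact (nat (\<mu> - int s)) * fact (b + j) / fact (nat (\<nu> - int s))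
        * (real a + 1) * (real b + real j + 1)"
    have r: "of_int \<mu> - real j = real a + 1" "of_int \<nu> - real (s - Suc j) = real b + real j + 1"
      "real (s - Suc j) + 1 = real (s - j)"
      using a b that by (auto simp: of_nat_diff)
    have "W (Suc j) * ((real j + 1) * (of_int \<mu> - real j))
        = - ((-1) ^ j * (real (s choose Suc j) * (real j + 1)) * F)"
      unfolding W_def e r F_def fact_Suc by simp
    also have "\<dots> = - ((-1) ^ j * (real (s choose j) * real (s - j)) * F)"
      by (simp only: c)
    also have "\<dots> = - (W j * ((real (s - Suc j) + 1) * (of_int \<nu> - real (s - Suc j))))"
      unfolding W_def e r F_def fact_Suc by simp
    finally show ?thesis .
  qed
  have "x1 (tvt \<mu> \<nu> s f g) = (\<Sum>j\<le>s. W j *\<^sub>R (x1 ((y1 ^^ j) f) * (y2 ^^ (s - j)) g))"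
    unfolding tvt_def W_def[symmetric] linear_sum[OF lin12(1)]
    by (simp add: linear_scale[OF lin12(1)] derivation_mult[OF der(1)] g)
  also have "\<dots> = (\<Sum>j<s. W (Suc j) *\<^sub>R (x1 ((y1 ^^ Suc j) f) * (y2 ^^ (s - Suc j)) g))"
    using f(1) by (subst sum.atMost_shift) simp
  also have "\<dots> = (\<Sum>j<s. (W (Suc j) * ((real j + 1) * (of_int \<mu> - real j)))
      *\<^sub>R ((y1 ^^ j) f * (y2 ^^ (s - Suc j)) g))"
    by (simp only: p.raise_lower_power[OF f(1,2)]) simp
  also have "\<dots> = - (\<Sum>j<s. (W j * ((real (s - Suc j) + 1) * (of_int \<nu> - real (s - Suc j))))
      *\<^sub>R ((y1 ^^ j) f * (y2 ^^ (s - Suc j)) g))"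
    using W by (simp flip: sum_negf)
  also have "(\<Sum>j<s. (W j * ((real (s - Suc j) + 1) * (of_int \<nu> - real (s - Suc j))))
      *\<^sub>R ((y1 ^^ j) f * (y2 ^^ (s - Suc j)) g)) = (\<Sum>j<s. W j *\<^sub>R ((y1 ^^ j) f * x2 ((y2 ^^ (s - j)) g)))"
  proof (rule sum.cong[OF refl])
    fix j assume "j \<in> {..<s}"
    hence "s - j = Suc (s - Suc j)" by auto
    thus "(W j * ((real (s - Suc j) + 1) * (of_int \<nu> - real (s - Suc j))))
        *\<^sub>R ((y1 ^^ j) f * (y2 ^^ (s - Suc j)) g) = W j *\<^sub>R ((y1 ^^ j) f * x2 ((y2 ^^ (s - j)) g))"
      by (simp only: q.raise_lower_power[OF g(1,2)]) simp
  qed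
  also have "\<dots> = (\<Sum>j\<le>s. W j *\<^sub>R ((y1 ^^ j) f * x2 ((y2 ^^ (s - j)) g)))"
    using g(1) by (simp flip: lessThan_Suc_atMost)
  also have "\<dots> = x2 (tvt \<mu> \<nu> s f g)"
    unfolding tvt_def W_def[symmetric] linear_sum[OF lin12(2)]
    by (simp add: linear_scale[OF lin12(2)] derivation_mult[OF der(2)] f)
  finally show ?thesis by simp
qed

text \<open>In summand \<open>j\<close> only \<open>s - j\<close> applications of \<open>x2\<close>
  are needed to bring the second factor back to a multiple of \<open>g\<close>; if
  \<open>j > 0\<close>, a further one gives 0. So only summand 0 survives, with a positive
  factor.\<close>

lemma tvt_leads: "leads x2 s (tvt \<mu> \<nu> s f g) (f * g)"
proof -
  have pow: "(x2 ^^ n) ((y1 ^^ j) f * v) = (y1 ^^ j) f * (x2 ^^ n) v" for n j v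
    by (induction n) (simp_all add: derivation_mult[OF der(2)] f)
  note lin = linear_funpow[OF lin12(2)]
  have vanish: "(x2 ^^ s) ((y2 ^^ (s - j)) g) = 0" if "0 < j" "j \<le> s" for j
  proof -
    obtain c where c: "(x2 ^^ (s - j)) ((y2 ^^ (s - j)) g) = c *\<^sub>R g"
      using q.raise_power_lower_power[OF g(1,2), of "s - j"] s by fastforce
    have "s = (j - 1) + Suc (s - j)" using that by simp
    hence "(x2 ^^ s) ((y2 ^^ (s - j)) g) = (x2 ^^ (j - 1)) (x2 ((x2 ^^ (s - j)) ((y2 ^^ (s - j)) g)))"
      by (metis funpow_add funpow.simps(2) o_apply)
    thus ?thesis by (simp add: c linear_scale[OF lin12(2)] g(1) linear_0[OF lin])
  qed
  obtain c where c: "c > 0" "(x2 ^^ s) ((y2 ^^ s) g) = c *\<^sub>R g"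
    using q.raise_power_lower_power[OF g(1,2), of s] s by fastforce
  \<comment> \<open>The transvectant coefficient at \<open>j = 0\<close>, where the factorials
    involving \<open>\<nu>\<close> cancel.\<close>
  define W0 :: real where "W0 = fact (nat \<mu>) / fact (nat (\<mu> - int s))"
  have "(x2 ^^ s) (tvt \<mu> \<nu> s f g) = (\<Sum>j\<le>s. if j = 0 then W0 *\<^sub>R (f * c *\<^sub>R g) else 0)"
    unfolding tvt_def linear_sum[OF lin]
    by (rule sum.cong[OF refl]) (auto simp: linear_scale[OF lin] pow vanish c W0_def)
  also have "\<dots> = (W0 * c) *\<^sub>R (f * g)" by simp
  finally have "(x2 ^^ s) (tvt \<mu> \<nu> s f g) = (W0 * c) *\<^sub>R (f * g)" .
  moreover have "W0 * c > 0" using c by (simp add: W0_def)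
  moreover have "x2 (f * g) = 0" using f(3)[of 0] by (simp add: derivation_mult[OF der(2)] g)
  ultimately show ?thesis unfolding leads_def by blast
qed

end

end

section \<open>Two groups of variables\<close>

lemma sum_UNIV_Plus:
  "sum f (UNIV :: ('a::finite + 'b::finite) set) = (\<Sum>a\<in>UNIV. f (Inl a)) + (\<Sum>b\<in>UNIV. f (Inr b))"
  by (simp add: sum.Plus flip: UNIV_Plus_UNIV)

lemma bdiag_nth [simp]:
  "bdiag A B $ Inl i $ Inl j = A $ i $ j" "bdiag A B $ Inr i' $ Inr j' = B $ i' $ j'"
  "bdiag A B $ Inl i $ Inr j' = 0" "bdiag A B $ Inr i' $ Inl j = 0"
  by (simp_all add: bdiag_def)

lemma vec_eq_Plus_iff:
  "M = N \<longleftrightarrow> (\<forall>i j. M $ Inl i $ Inl j = N $ Inl i $ Inl j) \<and> (\<forall>i j. M $ Inl i $ Inr j = N $ Inl i $ Inr j)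
    \<and> (\<forall>i j. M $ Inr i $ Inl j = N $ Inr i $ Inl j) \<and> (\<forall>i j. M $ Inr i $ Inr j = N $ Inr i $ Inr j)"
  for M N :: "real^('a::finite + 'b::finite)^('a + 'b)"
  unfolding vec_eq_iff split_sum_all by auto

lemma bdiag_add: "bdiag A B + bdiag A' B' = bdiag (A + A') (B + B')"
  and bdiag_diff: "bdiag A B - bdiag A' B' = bdiag (A - A') (B - B')"
  and bdiag_uminus: "- bdiag A B = bdiag (- A) (- B)"
  and bdiag_scaleR: "c *\<^sub>R bdiag A B = bdiag (c *\<^sub>R A) (c *\<^sub>R B)"
  by (simp_all add: vec_eq_Plus_iff)

lemma bdiag_mult: "bdiag A B ** bdiag A' B' = bdiag (A ** A') (B ** B')"
  by (simp add: vec_eq_Plus_iff matrix_matrix_mult_def sum_UNIV_Plus)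

text \<open>Padding with the zero triad presents an operator on one group of variables as a
  block-diagonal one, so the general results apply to it.\<close>

lemma sl2_triad_0: "sl2_triad 0 0 0"
  by (simp add: sl2_triad_def)

lemma sl2_triad_bdiag:
  "sl2_triad X Y Z \<Longrightarrow> sl2_triad X' Y' Z' \<Longrightarrow> sl2_triad (bdiag X X') (bdiag Y Y') (bdiag Z Z')"
  by (auto simp: sl2_triad_def bdiag_mult bdiag_diff bdiag_scaleR bdiag_uminus)

definition lpart :: "('a + 'b \<Rightarrow> nat) \<Rightarrow> 'a \<Rightarrow> nat" where "lpart m = (\<lambda>a. m (Inl a))"
definition rpart :: "('a + 'b \<Rightarrow> nat) \<Rightarrow> 'b \<Rightarrow> nat" where "rpart m = (\<lambda>b. m (Inr b))"

lemma parts_case_sum [simp]: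
  "lpart (case_sum a b) = a" "rpart (case_sum a b) = b" "case_sum (lpart m) (rpart m) = m"
  by (auto simp: lpart_def rpart_def fun_eq_iff split: sum.split)

lemma upd_parts:
  "m(Inl i := k) = case_sum ((lpart m)(i := k)) (rpart m)"
  "m(Inr j := k) = case_sum (lpart m) ((rpart m)(j := k))"
  by (auto simp: lpart_def rpart_def fun_eq_iff split: sum.split)

text \<open>Each block treats the exponents of the other group as parameters. This covers series
  that are not pure tensors.\<close>

lemma Dop_bdiag:
  "Dop (bdiag A B) u m = Dop A (\<lambda>a. u (case_sum a (rpart m))) (lpart m)
     + Dop B (\<lambda>b. u (case_sum (lpart m) b)) (rpart m)"
proof -
  have [simp]: "m (Inl i) = lpart m i" "m (Inr j) = rpart m j" for i j
    by (simp_all add: lpart_def rpart_def)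
  show ?thesis
    unfolding Dop_def sum_UNIV_Plus bdiag_nth Let_def
    by (simp add: upd_parts del: fun_upd_apply) (simp add: upd_parts cong: if_cong)
qed

definition ten :: "'a mser \<Rightarrow> 'b mser \<Rightarrow> ('a + 'b) mser" where
  "ten f g = Ser (tens (coeff f) (coeff g))"

lemma coeff_ten: "coeff (ten f g) m = coeff f (lpart m) * coeff g (rpart m)"
  by (simp add: ten_def tens_def lpart_def rpart_def)

lemma ten_linear:
  "ten (f + f') g = ten f g + ten f' g" "ten f (g + g') = ten f g + ten f g'"
  "ten (c *\<^sub>R f) g = c *\<^sub>R ten f g" "ten f (c *\<^sub>R g) = c *\<^sub>R ten f g"
  "ten 0 g = 0" "ten f 0 = 0"
  by (rule mser_eqI; simp add: coeff_ten algebra_simps)+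

lemma ten_1 [simp]: "ten 1 1 = 1"
proof (rule mser_eqI)
  fix m :: "'a + 'b \<Rightarrow> nat"
  have "m = (\<lambda>_. 0) \<longleftrightarrow> lpart m = (\<lambda>_. 0) \<and> rpart m = (\<lambda>_. 0)"
    by (auto simp: lpart_def rpart_def fun_eq_iff) (metis sumE)
  thus "coeff (ten 1 1) m = coeff 1 m"
    by (simp add: coeff_ten one_mser_def mps_one_def)
qed

lemma ten_mult: "ten f g * ten f' g' = ten (f * f') (g * g')"
proof (rule mser_eqI)
  fix m
  let ?S = "\<lambda>n. {(a, b). (\<lambda>v. a v + b v) = n}"
  have "coeff (ten (f * f') (g * g')) m =
    (\<Sum>(p, q)\<in>?S (lpart m) \<times> ?S (rpart m). (coeff f (fst p) * coeff f' (snd p)) * (coeff g (fst q) * coeff g' (snd q)))"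
    by (simp add: coeff_ten times_mser_def mps_mult_pairs case_prod_unfold sum_product sum.cartesian_product)
  also have "\<dots> = (\<Sum>(a, b)\<in>?S m. coeff (ten f g) a * coeff (ten f' g') b)"
    by (rule sum.reindex_bij_witness[of _
          "\<lambda>(a, b). ((lpart a, lpart b), (rpart a, rpart b))"
          "\<lambda>((a, b), (c, d)). (case_sum a c, case_sum b d)"])
       (auto simp: coeff_ten mult_ac lpart_def rpart_def fun_eq_iff split: sum.split)
  finally show "coeff (ten f g * ten f' g') m = coeff (ten (f * f') (g * g')) m"
    by (simp add: times_mser_def mps_mult_pairs)
qed

lemma DD_bdiag_ten: "DD (bdiag A B) (ten f g) = ten (DD A f) g + ten f (DD B g)"
proof (rule mser_eqI)
  fix m
  have "Dop A (\<lambda>a. coeff (ten f g) (case_sum a (rpart m))) (lpart m)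
      = coeff (DD A (coeff g (rpart m) *\<^sub>R f)) (lpart m)"
    by (simp add: DD_def coeff_ten scaleR_mser_def mult.commute)
  moreover have "Dop B (\<lambda>b. coeff (ten f g) (case_sum (lpart m) b)) (rpart m)
      = coeff (DD B (coeff f (lpart m) *\<^sub>R g)) (rpart m)"
    by (simp add: DD_def coeff_ten scaleR_mser_def)
  ultimately show "coeff (DD (bdiag A B) (ten f g)) m = coeff (ten (DD A f) g + ten f (DD B g)) m"
    by (subst DD_def) (simp add: Dop_bdiag DD_scaleR coeff_ten)
qed

lemma DD_0_matrix [simp]: "DD 0 f = 0"
  by (simp add: DD_eq)

lemma DD_one [simp]: "DD A 1 = 0"
  by (rule derivation_1[OF derivation_DD])

lemma DD_pow_ten:
  "(DD (bdiag A 0) ^^ n) (ten f g) = ten ((DD A ^^ n) f) g"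
  "(DD (bdiag 0 B) ^^ n) (ten f g) = ten f ((DD B ^^ n) g)"
  by (induction n) (simp_all add: DD_bdiag_ten ten_linear)

lemma DD_bdiag_split: "DD (bdiag A B) u = DD (bdiag A 0) u + DD (bdiag 0 B) u"
  by (simp add: bdiag_add flip: DD_matrix_add)

lemma two_sl2_bdiag:
  assumes "sl2_triad X Y Z" "sl2_triad X' Y' Z'"
  shows "two_sl2 (DD (bdiag Y 0)) (DD (bdiag X 0)) (DD (bdiag Z 0))
     (DD (bdiag 0 Y')) (DD (bdiag 0 X')) (DD (bdiag 0 Z'))"
  using sl2_ops_DD[OF sl2_triad_bdiag[OF assms(1) sl2_triad_0]]
    sl2_ops_DD[OF sl2_triad_bdiag[OF sl2_triad_0 assms(2)]]
  by (simp add: two_sl2_def two_sl2_axioms_def derivation_DD)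

lemma DD_bdiag_commute:
  "DD (bdiag A 0) (DD (bdiag 0 B) u) = DD (bdiag 0 B) (DD (bdiag A 0) u)"
  using DD_DD_commutator[of "bdiag A 0" "bdiag 0 B" u] by (simp add: bdiag_mult)

section \<open>Bidegrees in the two groups of variables\<close>

definition bideg :: "nat \<Rightarrow> nat \<Rightarrow> ('a::finite + 'b::finite) mser \<Rightarrow> bool" where
  "bideg d e u \<longleftrightarrow> wdeg (case_sum (\<lambda>_. 1) (\<lambda>_. 0)) d u \<and> wdeg (case_sum (\<lambda>_. 0) (\<lambda>_. 1)) e u"

lemma wt_parts:
  "wt (case_sum (\<lambda>_. 1) (\<lambda>_. 0)) m = wt (\<lambda>_. 1) (lpart m)"
  "wt (case_sum (\<lambda>_. 0) (\<lambda>_. 1)) m = wt (\<lambda>_. 1) (rpart m)"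
  "wt (\<lambda>_. 1) m = wt (\<lambda>_. 1) (lpart m) + wt (\<lambda>_. 1) (rpart m)"
  by (simp_all add: wt_def sum_UNIV_Plus lpart_def rpart_def)

lemma bideg_iff:
  "bideg d e u \<longleftrightarrow> (\<forall>m. coeff u m \<noteq> 0 \<longrightarrow> wt (\<lambda>_. 1) (lpart m) = d \<and> wt (\<lambda>_. 1) (rpart m) = e)"
  by (auto simp: bideg_def wdeg_def wt_parts simp del: One_nat_def)

lemma bideg_wdeg: "bideg d e u \<Longrightarrow> wdeg (\<lambda>_. 1) (d + e) u"
  by (simp add: bideg_iff wdeg_def wt_parts(3) del: One_nat_def)

lemma bideg_ten: "wdeg (\<lambda>_. 1) d f \<Longrightarrow> wdeg (\<lambda>_. 1) e g \<Longrightarrow> bideg d e (ten f g)"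
  by (simp add: bideg_iff wdeg_def coeff_ten del: One_nat_def)

lemma bideg_DD: "bideg d e u \<Longrightarrow> bideg d e (DD (bdiag A B) u)"
  unfolding bideg_def by (auto intro!: wdeg_DD split: sum.split simp: bdiag_def)

lemma bideg_DD_pow: "bideg d e u \<Longrightarrow> bideg d e ((DD (bdiag A B) ^^ n) u)"
  by (induction n) (auto intro: bideg_DD)

lemma bideg_diff: "bideg d e u \<Longrightarrow> bideg d e v \<Longrightarrow> bideg d e (u - v)"
  and bideg_scaleR: "bideg d e u \<Longrightarrow> bideg d e (c *\<^sub>R u)"
  and bideg_sum: "(\<And>i. i \<in> I \<Longrightarrow> bideg d e (f i)) \<Longrightarrow> bideg d e (sum f I)"
  and bideg_add: "bideg d e u \<Longrightarrow> bideg d e v \<Longrightarrow> bideg d e (u + v)"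
  and bideg_0: "bideg d e 0"
  by (auto simp: bideg_def intro: wdeg_diff wdeg_scaleR wdeg_sum wdeg_add)

lemma bideg_prod_power:
  "(\<And>i. i \<in> I \<Longrightarrow> bideg (d i) (e i) (f i)) \<Longrightarrow>
    bideg (\<Sum>i\<in>I. k i * d i) (\<Sum>i\<in>I. k i * e i) (\<Prod>i\<in>I. f i ^ k i)"
  by (auto simp: bideg_def intro!: wdeg_prod wdeg_power)

definition bitrunc :: "nat \<Rightarrow> nat \<Rightarrow> ('a::finite + 'b::finite) mser \<Rightarrow> ('a + 'b) mser" where
  "bitrunc d e u = trunc (case_sum (\<lambda>_. 1) (\<lambda>_. 0)) d (trunc (case_sum (\<lambda>_. 0) (\<lambda>_. 1)) e u)"

lemma bideg_bitrunc: "bideg d e (bitrunc d e u)"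
  unfolding bideg_def bitrunc_def by (metis trunc_commute wdeg_trunc)

lemma coeff_bitrunc: "coeff (bitrunc (wt (\<lambda>_. 1) (lpart m)) (wt (\<lambda>_. 1) (rpart m)) u) m = coeff u m"
  by (simp add: bitrunc_def trunc_def wt_parts del: One_nat_def)

lemma DD_bitrunc: "DD (bdiag A B) (bitrunc d e u) = bitrunc d e (DD (bdiag A B) u)"
  unfolding bitrunc_def
  by (subst DD_trunc, force simp: bdiag_def split: sum.splits,
      subst DD_trunc, auto simp: bdiag_def split: sum.splits)

lemma DD_bdiag_nilpotent:
  assumes "sl2_triad X Y Z" "sl2_triad X' Y' Z'"
  obtains N where "\<And>u. bideg d e u \<Longrightarrow> (DD (bdiag Y Y') ^^ N) u = 0"
proof -
  have "bdiag Z Z' ** bdiag Y Y' - bdiag Y Y' ** bdiag Z Z' = - (2 *\<^sub>R bdiag Y Y')"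
    using sl2_triad_bdiag[OF assms] by (simp add: sl2_triad_def)
  from DD_locally_nilpotent[OF this, of "d + e"] bideg_wdeg that show thesis by metis
qed

section \<open>Hilbert bases with standard preferred sets\<close>

text \<open>Eigenvalues of a derivation add under products. Eigenvalue 0 gives closure of kernels
  under monomials; the generator weights give \<open>wsum\<close>.\<close>

lemma eigen_prod_power:
  fixes D :: "'r::{comm_ring_1,real_algebra_1} \<Rightarrow> 'r"
  assumes "derivation D" "\<And>i. i \<in> I \<Longrightarrow> D (f i) = \<rho> i *\<^sub>R f i"
  shows "D (\<Prod>i\<in>I. f i ^ k i) = (\<Sum>i\<in>I. real (k i) * \<rho> i) *\<^sub>R (\<Prod>i\<in>I. f i ^ k i)"
proof -
  have pow: "D (f i ^ n) = (real n * \<rho> i) *\<^sub>R f i ^ n" if "i \<in> I" for i n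
    by (induction n)
       (simp_all add: derivation_1[OF assms(1)] derivation_mult[OF assms(1)] assms(2)[OF that]
          scaleR_add_left ring_distribs)
  have "J \<subseteq> I \<Longrightarrow> D (\<Prod>i\<in>J. f i ^ k i) = (\<Sum>i\<in>J. real (k i) * \<rho> i) *\<^sub>R (\<Prod>i\<in>J. f i ^ k i)" for J
    by (induction J rule: infinite_finite_induct)
       (simp_all add: derivation_1[OF assms(1)] derivation_mult[OF assms(1)] pow scaleR_add_left)
  thus ?thesis by simp
qed

lemma wsum_eq: "length k = length w \<Longrightarrow> wsum w k = (\<Sum>i<length w. w ! i * int (k ! i))"
  by (simp add: wsum_def sum_list_sum_nth atLeast0LessThan)

locale half =
  fixes X Y Z :: "real^'v::finite^'v" and bs :: "'v mps list" and ws :: "int list" and A :: "nat list set"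
  assumes triad: "sl2_triad X Y Z"
    and basis: "hilbert_basis (Dop Y) (Dop Z) bs ws"
    and preferred: "preferred_set (Dop Y) bs A"
    and standard: "standard_set A"
begin

definition mon :: "nat list \<Rightarrow> 'v mser" where
  "mon k = Ser (smono bs k)"

text \<open>A choice, since a zero generator is homogeneous of every degree.\<close>

definition gdeg :: "nat \<Rightarrow> nat" where
  "gdeg i = (SOME d. wdeg (\<lambda>_. 1) d (Ser (bs ! i)))"

definition mdeg :: "nat list \<Rightarrow> nat" where
  "mdeg k = (\<Sum>i<length bs. k ! i * gdeg i)"

lemma length_ws: "length ws = length bs"
  using basis by (simp add: hilbert_basis_def)

lemma mon_eq: "length k = length bs \<Longrightarrow> mon k = (\<Prod>i<length bs. Ser (bs ! i) ^ (k ! i))"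
  by (simp add: mon_def Ser_smono)

lemma mon_add: "length k = length bs \<Longrightarrow> length k' = length bs \<Longrightarrow> mon (map2 (+) k k') = mon k * mon k'"
  by (simp add: mon_eq power_add prod.distrib)

lemma mon_0: "mon (replicate (length bs) 0) = 1"
  by (simp add: mon_eq)

lemma mdeg_add: "length k = length bs \<Longrightarrow> length k' = length bs \<Longrightarrow> mdeg (map2 (+) k k') = mdeg k + mdeg k'"
  by (simp add: mdeg_def ring_distribs sum.distrib)

lemma mdeg_0: "mdeg (replicate (length bs) 0) = 0"
  by (simp add: mdeg_def)

lemma wdeg_gen: "i < length bs \<Longrightarrow> wdeg (\<lambda>_. 1) (gdeg i) (Ser (bs ! i))"
  using basis unfolding gdeg_def
  by (intro someI_ex[of "\<lambda>d. wdeg (\<lambda>_. 1) d (Ser (bs ! i))"])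
     (auto simp: hilbert_basis_def homogeneous_def wdeg_def wt_def)

lemma wdeg_mon: "length k = length bs \<Longrightarrow> wdeg (\<lambda>_. 1) (mdeg k) (mon k)"
  unfolding mon_eq mdeg_def by (intro wdeg_prod wdeg_power wdeg_gen) auto

lemma gen_raise: "i < length bs \<Longrightarrow> DD Y (Ser (bs ! i)) = 0"
  and gen_weight: "i < length bs \<Longrightarrow> DD Z (Ser (bs ! i)) = of_int (ws ! i) *\<^sub>R Ser (bs ! i)"
  using basis
  by (auto simp: hilbert_basis_def DD_def mps_zero_def zero_mser_def scaleR_mser_def)

lemma mon_raise: "length k = length bs \<Longrightarrow> DD Y (mon k) = 0"
  unfolding mon_eq
  by (subst eigen_prod_power[OF derivation_DD, of _ _ _ "\<lambda>_. 0"]) (auto simp: gen_raise)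

lemma mon_weight: "length k = length bs \<Longrightarrow> DD Z (mon k) = of_int (wsum ws k) *\<^sub>R mon k"
  unfolding mon_eq
  by (subst eigen_prod_power[OF derivation_DD, of _ _ _ "\<lambda>i. of_int (ws ! i)"])
     (auto simp: gen_weight wsum_eq length_ws mult.commute)

lemma length_A: "k \<in> A \<Longrightarrow> length k = length bs"
  using preferred by (auto simp: preferred_set_def)

lemma independent_mon:
  assumes "finite F" "F \<subseteq> A" "(\<Sum>k\<in>F. c k *\<^sub>R mon k) = 0" "k \<in> F"
  shows "c k = 0"
proof -
  have "(\<Sum>k\<in>F. c k * smono bs k m) = 0" for m
    using arg_cong[OF assms(3), of "\<lambda>u. coeff u m"] by (simp add: coeff_sum mon_def)
  thus ?thesis using preferred assms unfolding preferred_set_def by blast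
qed

definition layer :: "nat \<Rightarrow> nat list set" where
  "layer d = {k \<in> A. mdeg k = d}"

lemma layer_A: "layer d \<subseteq> A"
  by (auto simp: layer_def)

text \<open>A generator occurring in an element of \<open>A\<close> is not constant: otherwise lowering its exponent
  by one would give a proportional monomial, again with exponent in \<open>A\<close>.\<close>

lemma gdeg_pos:
  assumes k: "k \<in> A" and i: "i < length bs" "k ! i > 0"
  shows "gdeg i > 0"
proof (rule ccontr)
  assume "\<not> gdeg i > 0"
  hence deg0: "wdeg (\<lambda>_. 1) 0 (Ser (bs ! i))" using wdeg_gen[OF i(1)] by simp
  define r where "r = (bs ! i) (\<lambda>_. 0)"
  have const: "Ser (bs ! i) = r *\<^sub>R 1"
  proof (rule mser_eqI)
    fix m
    show "coeff (Ser (bs ! i)) m = coeff (r *\<^sub>R 1) m"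
    proof (cases "m = (\<lambda>_. 0)")
      case False
      thus ?thesis using deg0 by (auto simp: one_mser_def mps_one_def wdeg_def wt_def fun_eq_iff)
    qed (simp add: r_def one_mser_def mps_one_def)
  qed
  let ?k = "k[i := k ! i - 1]"
  have len: "length k = length bs" using k by (rule length_A)
  have "?k \<in> A"
    using standard k i len unfolding standard_set_def by (auto simp: nth_list_update)
  have "mon k = Ser (bs ! i) ^ (k ! i) * (\<Prod>j\<in>{..<length bs} - {i}. Ser (bs ! j) ^ (k ! j))"
    using i len by (simp add: mon_eq prod.remove)
  also have "Ser (bs ! i) ^ (k ! i) = Ser (bs ! i) * Ser (bs ! i) ^ (?k ! i)"
    using i len by (cases "k ! i") auto
  also have "(\<Prod>j\<in>{..<length bs} - {i}. Ser (bs ! j) ^ (k ! j))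
      = (\<Prod>j\<in>{..<length bs} - {i}. Ser (bs ! j) ^ (?k ! j))"
    by (rule prod.cong) auto
  also have "Ser (bs ! i) * Ser (bs ! i) ^ (?k ! i) * \<dots> = Ser (bs ! i) * mon ?k"
    using i len by (simp add: mon_eq prod.remove[of _ i] mult.assoc del: nth_list_update_eq)
  finally have eq: "mon k = r *\<^sub>R mon ?k" by (simp add: const)
  have ne: "k \<noteq> ?k"
    using i len by (metis diff_less less_irrefl nth_list_update_eq zero_less_one)
  \<comment> \<open>The coefficient 1 of \<open>mon k\<close> makes this relation nontrivial even if
    \<open>r = 0\<close>.\<close>
  have "(\<Sum>l\<in>{k, ?k}. (if l = k then 1 else - r) *\<^sub>R mon l) = 0"
    using ne by (simp add: eq)
  from independent_mon[OF _ _ this, of k] show False using k \<open>?k \<in> A\<close> by simp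
qed

text \<open>Generators that occur have degree at least 1, so every exponent is bounded by the degree
  of the monomial.\<close>

lemma finite_layer: "finite (layer d)"
proof (rule finite_subset)
  show "layer d \<subseteq> {k. set k \<subseteq> {..d} \<and> length k = length bs}"
  proof (intro subsetI CollectI conjI)
    fix k n assume k: "k \<in> layer d"
    hence kA: "k \<in> A" and d: "mdeg k = d" by (auto simp: layer_def)
    show len: "length k = length bs" using kA by (rule length_A)
    assume "n \<in> set k"
    then obtain i where i: "i < length bs" "n = k ! i" using len by (metis in_set_conv_nth)
    show "n \<in> {..d}"
    proof (cases "n = 0")
      case False
      hence "n \<le> k ! i * gdeg i" using gdeg_pos[OF kA i(1)] i by (cases "gdeg i") auto
      also have "\<dots> \<le> mdeg k" unfolding mdeg_def using i by (intro member_le_sum) auto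
      finally show ?thesis using d by simp
    qed simp
  qed
qed (simp add: finite_lists_length_eq)

text \<open>For homogeneous \<open>f\<close>, the terms of other degrees may be dropped from the
  formal combination, which leaves a finite sum over one layer.\<close>

lemma kernel_expansion:
  assumes f: "wdeg (\<lambda>_. 1) d f" "DD Y f = 0"
  shows "\<exists>c. f = (\<Sum>k\<in>layer d. c k *\<^sub>R mon k)"
proof -
  have "Dop Y (coeff f) = mps_zero"
    using f(2) by (simp add: DD_def zero_mser_def mps_zero_def)
  hence "is_lincomb (smono bs) A (coeff f)" using preferred by (simp add: preferred_set_def)
  then obtain c where c: "\<And>m. finite {k\<in>A. c k * smono bs k m \<noteq> 0}"
     "\<And>m. coeff f m = (\<Sum>k\<in>{k\<in>A. c k * smono bs k m \<noteq> 0}. c k * smono bs k m)"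
    unfolding is_lincomb_def by blast
  have mon: "wt (\<lambda>_. 1) m = d \<longleftrightarrow> k \<in> layer d" if "k \<in> A" "smono bs k m \<noteq> 0" for k m
    using wdeg_mon[OF length_A[OF that(1)]] that by (auto simp: wdeg_def mon_def layer_def)
  have "f = (\<Sum>k\<in>layer d. c k *\<^sub>R mon k)"
  proof (rule mser_eqI)
    fix m
    show "coeff f m = coeff (\<Sum>k\<in>layer d. c k *\<^sub>R mon k) m"
    proof (cases "wt (\<lambda>_. 1) m = d")
      case True
      have "(\<Sum>k\<in>{k\<in>A. c k * smono bs k m \<noteq> 0}. c k * smono bs k m) = (\<Sum>k\<in>layer d. c k * smono bs k m)"
        using mon True by (intro sum.mono_neutral_left finite_layer) (auto simp: layer_def)
      thus ?thesis using c(2)[of m] by (simp add: coeff_sum mon_def)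
    next
      case False
      hence f0: "coeff f m = 0" using f(1) by (auto simp: wdeg_def)
      have "c k * smono bs k m = 0" if "k \<in> layer d" for k
        using mon[of k m] that False layer_A by auto
      hence "(\<Sum>k\<in>layer d. c k * smono bs k m) = 0" by (intro sum.neutral) blast
      with f0 show ?thesis by (simp add: coeff_sum mon_def)
    qed
  qed
  thus ?thesis by blast
qed

end

section \<open>Both bases together: the joint kernel of \<open>x1\<close> and \<open>x2\<close>, and
  leading terms in it\<close>

locale two_halves =
  a: half Xa Ya Za \<alpha> wa Aa + g: half Xg Yg Zg \<beta> wb Ag
  for Xa Ya Za :: "real^'a::finite^'a" and \<alpha> wa Aa
    and Xg Yg Zg :: "real^'b::finite^'b" and \<beta> wb Ag
begin

abbreviation "x1 \<equiv> DD (bdiag Ya 0 :: real^('a + 'b)^('a + 'b))"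
abbreviation "x2 \<equiv> DD (bdiag 0 Yg :: real^('a + 'b)^('a + 'b))"
abbreviation "y1 \<equiv> DD (bdiag Xa 0 :: real^('a + 'b)^('a + 'b))"
abbreviation "y2 \<equiv> DD (bdiag 0 Xg :: real^('a + 'b)^('a + 'b))"
abbreviation "z1 \<equiv> DD (bdiag Za 0 :: real^('a + 'b)^('a + 'b))"
abbreviation "z2 \<equiv> DD (bdiag 0 Zg :: real^('a + 'b)^('a + 'b))"

sublocale two_sl2 x1 y1 z1 x2 y2 z2
  by (rule two_sl2_bdiag[OF a.triad g.triad])

definition symb :: "nat list \<Rightarrow> nat list \<Rightarrow> ('a + 'b) mser" where
  "symb k l = ten (a.mon k) (g.mon l)"

text \<open>The coefficient of the monomial with exponent \<open>n\<close> in the second group, as a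
  series in the first group.\<close>

definition slice :: "('a + 'b) mser \<Rightarrow> ('b \<Rightarrow> nat) \<Rightarrow> 'a mser" where
  "slice u n = Ser (\<lambda>m. coeff u (case_sum m n))"

lemma coeff_slice: "coeff u m = coeff (slice u (rpart m)) (lpart m)"
  by (simp add: slice_def)

lemma slice_symb_sum:
  "slice (\<Sum>k\<in>I. \<Sum>l\<in>J. c k l *\<^sub>R symb k l) n = (\<Sum>k\<in>I. (\<Sum>l\<in>J. c k l * coeff (g.mon l) n) *\<^sub>R a.mon k)"
  by (rule mser_eqI) (simp add: slice_def coeff_sum symb_def coeff_ten sum_distrib_right sum_distrib_left mult_ac)

lemma independent_symb:
  assumes "finite I" "I \<subseteq> Aa" "finite J" "J \<subseteq> Ag"
    and 0: "(\<Sum>k\<in>I. \<Sum>l\<in>J. c k l *\<^sub>R symb k l) = 0" and "k \<in> I" "l \<in> J"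
  shows "c k l = 0"
proof -
  have "(\<Sum>l\<in>J. c k l *\<^sub>R g.mon l) = 0"
  proof (rule mser_eqI)
    fix n
    have "(\<Sum>k\<in>I. (\<Sum>l\<in>J. c k l * coeff (g.mon l) n) *\<^sub>R a.mon k) = 0"
      using 0 slice_symb_sum[of c J I n] by (simp add: slice_def zero_mser_def)
    from a.independent_mon[OF assms(1,2) this \<open>k \<in> I\<close>]
    show "coeff (\<Sum>l\<in>J. c k l *\<^sub>R g.mon l) n = coeff 0 n" by (simp add: coeff_sum)
  qed
  from g.independent_mon[OF assms(3,4) this \<open>l \<in> J\<close>] show ?thesis .
qed

text \<open>Each slice expands in the \<alpha>-monomials. For fixed \<open>k\<close> its
  coefficients \<open>C n k\<close>, read as a series in the second group, are again homogeneous and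
  in the kernel, hence expand in the \<beta>-monomials.\<close>

lemma joint_kernel_expansion:
  assumes u: "bideg d e u" "x1 u = 0" "x2 u = 0"
  shows "\<exists>c. u = (\<Sum>k\<in>a.layer d. \<Sum>l\<in>g.layer e. c k l *\<^sub>R symb k l)"
proof -
  have "\<exists>c. slice u n = (\<Sum>k\<in>a.layer d. c k *\<^sub>R a.mon k)" for n
  proof (rule a.kernel_expansion)
    show "wdeg (\<lambda>_. 1) d (slice u n)" using u(1) by (auto simp: bideg_iff wdeg_def slice_def)
    have "coeff (DD Ya (slice u n)) m = coeff (x1 u) (case_sum m n)" for m
      by (simp add: DD_def Dop_bdiag slice_def) (simp add: Dop_def)
    thus "DD Ya (slice u n) = 0" by (intro mser_eqI) (simp add: u(2))
  qed
  then obtain C where C: "\<And>n. slice u n = (\<Sum>k\<in>a.layer d. C n k *\<^sub>R a.mon k)" by metis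
  have "\<exists>c. Ser (\<lambda>n. C n k) = (\<Sum>l\<in>g.layer e. c l *\<^sub>R g.mon l)" if k: "k \<in> a.layer d" for k
  proof (rule g.kernel_expansion)
    show "wdeg (\<lambda>_. 1) e (Ser (\<lambda>n. C n k))"
      unfolding wdeg_def coeff_Ser
    proof (intro allI impI)
      fix n assume "C n k \<noteq> 0"
      hence "slice u n \<noteq> 0"
        using a.independent_mon[OF a.finite_layer a.layer_A _ k] C by metis
      then obtain m where "coeff u (case_sum m n) \<noteq> 0"
        by (metis mser_eqI coeff_0 slice_def coeff_Ser)
      thus "wt (\<lambda>_. 1) n = e" using u(1) unfolding bideg_iff by (metis parts_case_sum(2))
    qed
    show "DD Yg (Ser (\<lambda>n. C n k)) = 0"
    proof (rule mser_eqI)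
      fix n
      \<comment> \<open>Coefficientwise this is \<open>x2 u = 0\<close>; independence of the
        \<alpha>-monomials then kills each coefficient separately.\<close>
      have "(\<Sum>k\<in>a.layer d. coeff (DD Yg (Ser (\<lambda>n. C n k))) n *\<^sub>R a.mon k) = 0"
      proof (rule mser_eqI)
        fix m
        have "Ser (\<lambda>n. coeff u (case_sum m n)) = (\<Sum>k\<in>a.layer d. coeff (a.mon k) m *\<^sub>R Ser (\<lambda>n. C n k))"
          by (rule mser_eqI) (simp add: coeff_slice[of u] C coeff_sum mult.commute)
        hence "DD Yg (Ser (\<lambda>n. coeff u (case_sum m n)))
            = (\<Sum>k\<in>a.layer d. coeff (a.mon k) m *\<^sub>R DD Yg (Ser (\<lambda>n. C n k)))"
          by (simp only: DD_sum DD_scaleR)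
        moreover have "coeff (DD Yg (Ser (\<lambda>n. coeff u (case_sum m n)))) n = coeff (x2 u) (case_sum m n)"
          by (simp add: DD_def Dop_bdiag) (simp add: Dop_def)
        ultimately show "coeff (\<Sum>k\<in>a.layer d. coeff (DD Yg (Ser (\<lambda>n. C n k))) n *\<^sub>R a.mon k) m = coeff 0 m"
          by (simp add: u(3) coeff_sum mult.commute)
      qed
      from a.independent_mon[OF a.finite_layer a.layer_A this k]
      show "coeff (DD Yg (Ser (\<lambda>n. C n k))) n = coeff 0 n" by simp
    qed
  qed
  then obtain c where c: "\<And>k. k \<in> a.layer d \<Longrightarrow> Ser (\<lambda>n. C n k) = (\<Sum>l\<in>g.layer e. c k l *\<^sub>R g.mon l)"
    by metis
  have "C n k = (\<Sum>l\<in>g.layer e. c k l * coeff (g.mon l) n)" if "k \<in> a.layer d" for n k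
    using arg_cong[OF c[OF that], of "\<lambda>v. coeff v n"] by (simp add: coeff_sum)
  hence "slice u n = slice (\<Sum>k\<in>a.layer d. \<Sum>l\<in>g.layer e. c k l *\<^sub>R symb k l) n" for n
    unfolding slice_symb_sum C by (intro sum.cong) auto
  hence "u = (\<Sum>k\<in>a.layer d. \<Sum>l\<in>g.layer e. c k l *\<^sub>R symb k l)"
    by (intro mser_eqI) (simp only: coeff_slice)
  thus ?thesis by blast
qed

lemma weight_symb:
  assumes "k \<in> Aa" "l \<in> Ag"
  shows "z1 (symb k l) = of_int (wsum wa k) *\<^sub>R symb k l" "z2 (symb k l) = of_int (wsum wb l) *\<^sub>R symb k l"
  using a.mon_weight[OF a.length_A[OF assms(1)]] g.mon_weight[OF g.length_A[OF assms(2)]]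
  by (simp_all add: symb_def DD_bdiag_ten ten_linear)

text \<open>On the kernel of \<open>x1 + x2\<close> the operators \<open>x1\<close> and \<open>- x2\<close> agree, so the leading term
  \<open>(x2 ^^ s) h\<close> lies in both kernels and in both images of the \<open>s\<close>-th powers.\<close>

lemma leading_term_span:
  assumes h: "bideg d e h" "x1 h + x2 h = 0" "x2 ((x2 ^^ s) h) = 0"
  shows "(x2 ^^ s) h \<in> span {symb k l | k l. in_cone wa wb (k, l, s) \<and> k \<in> a.layer d \<and> l \<in> g.layer e}"
proof -
  let ?u = "(x2 ^^ s) h"
  have comm: "x1 ((x2 ^^ n) v) = (x2 ^^ n) (x1 v)" for n v
    by (induction n) (simp_all add: DD_bdiag_commute)
  have x1h: "x1 h = (-1) *\<^sub>R x2 h" using h(2) by (simp add: eq_neg_iff_add_eq_0)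
  have pow: "(x1 ^^ n) h = ((-1) ^ n) *\<^sub>R (x2 ^^ n) h" for n
  proof (induction n)
    case (Suc n)
    have "(x1 ^^ Suc n) h = ((-1) ^ n) *\<^sub>R (x2 ^^ n) (x1 h)"
      using Suc by (simp add: DD_scaleR comm)
    also have "(x2 ^^ n) (x1 h) = (-1) *\<^sub>R (x2 ^^ Suc n) h"
      unfolding x1h linear_scale[OF linear_funpow[OF linear_DD]] by (simp add: funpow_swap1)
    finally show ?case by simp
  qed simp
  have x1u: "x1 ?u = 0"
  proof -
    have "x1 ?u = (-1) *\<^sub>R (x2 ^^ s) (x2 h)"
      unfolding comm x1h linear_scale[OF linear_funpow[OF linear_DD]] ..
    also have "(x2 ^^ s) (x2 h) = 0" using h(3) by (simp add: funpow_swap1)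
    finally show ?thesis by simp
  qed
  have bu: "bideg d e ?u" using h(1) by (rule bideg_DD_pow)
  obtain c where c: "?u = (\<Sum>k\<in>a.layer d. \<Sum>l\<in>g.layer e. c k l *\<^sub>R symb k l)"
    using joint_kernel_expansion[OF bu x1u h(3)] by blast
  let ?I = "a.layer d \<times> g.layer e"
  have c': "?u = (\<Sum>i\<in>?I. c (fst i) (snd i) *\<^sub>R symb (fst i) (snd i))"
    unfolding c sum.cartesian_product by (simp add: case_prod_unfold)
  have indep: "c' i = 0" if "(\<Sum>i\<in>?I. c' i *\<^sub>R symb (fst i) (snd i)) = 0" "i \<in> ?I" for c' i
  proof -
    have "(\<Sum>k\<in>a.layer d. \<Sum>l\<in>g.layer e. c' (k, l) *\<^sub>R symb k l) = 0"
      using that(1) unfolding sum.cartesian_product by (simp add: case_prod_unfold)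
    from independent_symb[OF a.finite_layer a.layer_A g.finite_layer g.layer_A this, of "fst i" "snd i"]
    show ?thesis using that(2) by auto
  qed
  \<comment> \<open>\<open>weights_ge\<close> needs one nilpotency exponent for a whole set stable
    under lowering; a single bidegree provides it.\<close>
  let ?S = "{v :: ('a + 'b) mser. bideg d e v}"
  obtain N1 where N1: "\<And>v. bideg d e v \<Longrightarrow> (x1 ^^ N1) v = 0"
    using DD_bdiag_nilpotent[OF a.triad sl2_triad_0] by blast
  obtain N2 where N2: "\<And>v. bideg d e v \<Longrightarrow> (x2 ^^ N2) v = 0"
    using DD_bdiag_nilpotent[OF sl2_triad_0 g.triad] by blast
  have in_layer: "k \<in> a.layer d \<Longrightarrow> k \<in> Aa" "l \<in> g.layer e \<Longrightarrow> l \<in> Ag" for k l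
    using a.layer_A g.layer_A by blast+
  have w: "int s \<le> wsum wa k \<and> int s \<le> wsum wb l"
    if kl: "k \<in> a.layer d" "l \<in> g.layer e" "c k l \<noteq> 0" for k l
  proof
    \<comment> \<open>The sign makes \<open>?u\<close> itself, not only a multiple, an image under
      \<open>x1 ^^ s\<close>.\<close>
    have 1: "(x1 ^^ s) (((-1) ^ s) *\<^sub>R h) = ?u"
      by (simp add: linear_scale[OF linear_funpow[OF linear_DD]] pow flip: power_add mult_2)
    have "x1 ((x1 ^^ s) (((-1) ^ s) *\<^sub>R h)) = 0" unfolding 1 by (rule x1u)
    hence "real s \<le> of_int (wsum wa (fst (k, l)))"
      by (rule p.weights_ge[where S = ?S and I = ?I and v = "\<lambda>i. symb (fst i) (snd i)"
            and N = N1 and c = "\<lambda>i. c (fst i) (snd i)" and \<rho> = "\<lambda>i. of_int (wsum wa (fst i))", rotated -4])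
         (use kl N1 indep h(1) in \<open>auto intro: bideg_DD bideg_scaleR weight_symb trans[OF 1 c'] simp: in_layer\<close>)
    thus "int s \<le> wsum wa k" by simp
    from h(3) have "real s \<le> of_int (wsum wb (snd (k, l)))"
      by (rule q.weights_ge[where S = ?S and I = ?I and v = "\<lambda>i. symb (fst i) (snd i)"
            and N = N2 and c = "\<lambda>i. c (fst i) (snd i)" and \<rho> = "\<lambda>i. of_int (wsum wb (snd i))", rotated -4])
         (use kl N2 indep h(1) in \<open>auto intro: bideg_DD bideg_scaleR weight_symb c' simp: in_layer\<close>)
    thus "int s \<le> wsum wb l" by simp
  qed
  show ?thesis
    unfolding c
  proof (intro span_sum)
    fix k l assume kl: "k \<in> a.layer d" "l \<in> g.layer e"
    show "c k l *\<^sub>R symb k l \<in> span {symb k l | k l. in_cone wa wb (k, l, s) \<and> k \<in> a.layer d \<and> l \<in> g.layer e}"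
    proof (cases "c k l = 0")
      case False
      hence "in_cone wa wb (k, l, s)"
        using w kl in_layer a.length_A g.length_A a.length_ws g.length_ws
        by (auto simp: in_cone_def)
      thus ?thesis using kl by (intro span_scale span_base) blast
    qed (simp add: span_zero)
  qed
qed

end

section \<open>The transvectant cone\<close>

text \<open>\<open>map2\<close> truncates to the shorter list, so the monoid laws of
  \<open>cadd\<close> require fixed lengths.\<close>

definition cone_len :: "nat \<Rightarrow> nat \<Rightarrow> cone_elt \<Rightarrow> bool" where
  "cone_len p q c \<longleftrightarrow> length (fst c) = p \<and> length (fst (snd c)) = q"

text \<open>An additive size, positive off zero: the termination measure for splitting cone
  elements.\<close>

definition csize :: "cone_elt \<Rightarrow> nat" where
  "csize c = sum_list (fst c) + sum_list (fst (snd c)) + snd (snd c)"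

lemma map2_add_0: "length k = n \<Longrightarrow> map2 (+) k (replicate n 0) = k" for k :: "nat list"
  by (rule nth_equalityI) auto

lemma map2_0_add: "length k = n \<Longrightarrow> map2 (+) (replicate n 0) k = k" for k :: "nat list"
  by (rule nth_equalityI) auto

lemma map2_add_assoc:
  "length a = length b \<Longrightarrow> length b = length c \<Longrightarrow>
    map2 (+) (map2 (+) a b) c = map2 (+) a (map2 (+) b c)" for a b c :: "nat list"
  by (rule nth_equalityI) auto

lemma cone_len_czero: "cone_len p q (czero p q)"
  and cone_len_cadd: "cone_len p q c \<Longrightarrow> cone_len p q d \<Longrightarrow> cone_len p q (cadd c d)"
  and cadd_czero: "cone_len p q c \<Longrightarrow> cadd c (czero p q) = c"
  and czero_cadd: "cone_len p q c \<Longrightarrow> cadd (czero p q) c = c"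
  and cadd_assoc: "cone_len p q a \<Longrightarrow> cone_len p q b \<Longrightarrow> cone_len p q c \<Longrightarrow>
    cadd (cadd a b) c = cadd a (cadd b c)"
  by (auto simp: cone_len_def czero_def cadd_def map2_add_0 map2_0_add map2_add_assoc
      split: prod.splits)

lemma sum_list_map2_add: "length a = length b \<Longrightarrow> sum_list (map2 (+) a b) = sum_list a + sum_list b"
  for a b :: "nat list"
  by (induction a b rule: list_induct2) auto

lemma csize_cadd: "cone_len p q c \<Longrightarrow> cone_len p q d \<Longrightarrow> csize (cadd c d) = csize c + csize d"
  by (auto simp: csize_def cadd_def cone_len_def sum_list_map2_add split: prod.splits)

lemma csize_pos: "cone_len p q c \<Longrightarrow> c \<noteq> czero p q \<Longrightarrow> csize c > 0"
  by (cases c) (auto simp: csize_def czero_def cone_len_def intro: replicate_eqI)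

lemma in_cone_len: "in_cone wa wb c \<Longrightarrow> cone_len (length wa) (length wb) c"
  by (auto simp: in_cone_def cone_len_def)

lemma foldr_cadd_len:
  "(\<And>c. c \<in> set ps \<Longrightarrow> cone_len p q c) \<Longrightarrow> cone_len p q (foldr cadd ps (czero p q))"
  by (induction ps) (auto intro: cone_len_czero cone_len_cadd)

lemma foldr_cadd_append:
  assumes "\<And>c. c \<in> set ps \<union> set qs \<Longrightarrow> cone_len p q c"
  shows "foldr cadd (ps @ qs) (czero p q)
    = cadd (foldr cadd ps (czero p q)) (foldr cadd qs (czero p q))"
  using assms
proof (induction ps)
  case Nil
  thus ?case by (simp add: czero_cadd foldr_cadd_len)
next
  case (Cons a ps)
  have "cadd (cadd a (foldr cadd ps (czero p q))) (foldr cadd qs (czero p q))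
      = cadd a (cadd (foldr cadd ps (czero p q)) (foldr cadd qs (czero p q)))"
    by (rule cadd_assoc; (rule foldr_cadd_len)?; rule Cons.prems; simp)
  thus ?case using Cons by simp
qed

text \<open>Both summands lie componentwise below the sum, so standardness passes admissibility down
  to them.\<close>

lemma admissible_cadd:
  assumes std: "standard_set Aa" "standard_set Ag"
    and len: "cone_len p q a" "cone_len p q b" and adm: "admissible Aa Ag (cadd a b)"
  shows "admissible Aa Ag a" "admissible Aa Ag b"
proof -
  have std': "k \<in> A" "k' \<in> A"
    if "standard_set A" "map2 (+) k k' \<in> A" "length k = length k'" for A and k k' :: "nat list"
  proof -
    have *: "k'' \<in> A" if "length k'' = length (map2 (+) k k')"
      "\<forall>i<length (map2 (+) k k'). k'' ! i \<le> map2 (+) k k' ! i" for k''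
      using \<open>standard_set A\<close> \<open>map2 (+) k k' \<in> A\<close> that unfolding standard_set_def by blast
    show "k \<in> A" by (rule *) (use that(3) in auto)
    show "k' \<in> A" by (rule *) (use that(3) in auto)
  qed
  obtain k l s k' l' s' where ab: "a = (k, l, s)" "b = (k', l', s')" by (metis prod_cases3)
  have "k \<in> Aa \<and> k' \<in> Aa" "l \<in> Ag \<and> l' \<in> Ag"
    using std'[OF std(1), of k k'] std'[OF std(2), of l l'] len adm
    by (simp_all add: ab admissible_def cadd_def cone_len_def)
  thus "admissible Aa Ag a" "admissible Aa Ag b" by (auto simp: ab admissible_def)
qed

text \<open>A nonzero element that is not prime splits into two nonzero parts of smaller size, both
  still admissible; zero is the empty sum.\<close>

theorem admissible_prime_decomposition:
  assumes "standard_set Aa" "standard_set Ag"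
  shows "in_cone wa wb c \<Longrightarrow> admissible Aa Ag c \<Longrightarrow>
    \<exists>ps. (\<forall>\<pi>\<in>set ps. cone_prime wa wb \<pi> \<and> admissible Aa Ag \<pi>)
      \<and> c = foldr cadd ps (czero (length wa) (length wb))"
proof (induction "csize c" arbitrary: c rule: less_induct)
  case less
  let ?O = "czero (length wa) (length wb)"
  consider "c = ?O" | "cone_prime wa wb c"
    | a b where "in_cone wa wb a" "in_cone wa wb b" "a \<noteq> ?O" "b \<noteq> ?O" "c = cadd a b"
    using less.prems unfolding cone_prime_def by blast
  thus ?case
  proof cases
    case 1
    thus ?thesis by (intro exI[of _ "[]"]) simp
  next
    case 2
    thus ?thesis using less.prems by (intro exI[of _ "[c]"]) (simp add: cadd_czero in_cone_len)
  next
    case 3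
    note len = in_cone_len[OF 3(1)] in_cone_len[OF 3(2)]
    note adm = admissible_cadd[OF assms len less.prems(2)[unfolded 3(5)]]
    have "csize a < csize c" "csize b < csize c"
      using csize_pos[OF len(1) 3(3)] csize_pos[OF len(2) 3(4)] csize_cadd[OF len] 3(5) by auto
    with less.hyps 3 adm obtain ps qs where
      ps: "\<forall>\<pi>\<in>set ps. cone_prime wa wb \<pi> \<and> admissible Aa Ag \<pi>" "a = foldr cadd ps ?O" and
      qs: "\<forall>\<pi>\<in>set qs. cone_prime wa wb \<pi> \<and> admissible Aa Ag \<pi>" "b = foldr cadd qs ?O"
      by metis
    have "foldr cadd (ps @ qs) ?O = c"
      unfolding 3(5) ps(2) qs(2)
      by (rule foldr_cadd_append) (use ps qs in \<open>auto simp: cone_prime_def intro: in_cone_len\<close>)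
    thus ?thesis using ps(1) qs(1) by (intro exI[of _ "ps @ qs"]) auto
  qed
qed

section \<open>Multiplicities and linear combinations\<close>

text \<open>Converts a list of factors with repetitions into an exponent vector over an enumeration;
  distinctness ensures that each factor is counted at one position only.\<close>

lemma prod_power_count:
  fixes f :: "'i \<Rightarrow> 'r::comm_monoid_mult"
  assumes "distinct xs" "set ps \<subseteq> set xs"
  shows "(\<Prod>i<length xs. f (xs ! i) ^ count_list ps (xs ! i)) = prod_list (map f ps)"
proof -
  have "(\<Prod>x\<in>X. f x ^ count_list ps x) = prod_list (map f ps)" if "set ps \<subseteq> X" "finite X" for X
    using that(1)
  proof (induction ps)
    case (Cons p ps)
    have "(\<Prod>x\<in>X. f x ^ count_list (p # ps) x)
        = (\<Prod>x\<in>X. (if x = p then f x else 1) * f x ^ count_list ps x)"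
      by (rule prod.cong) auto
    also have "\<dots> = f p * (\<Prod>x\<in>X. f x ^ count_list ps x)"
      using Cons.prems that(2) by (simp add: prod.distrib prod.delta)
    finally show ?case using Cons by simp
  qed simp
  from this[of "set xs"] have "(\<Prod>x\<in>set xs. f x ^ count_list ps x) = prod_list (map f ps)"
    using assms(2) by simp
  thus ?thesis
    using prod.reindex_bij_betw[OF bij_betw_nth[OF assms(1) refl refl], of "\<lambda>x. f x ^ count_list ps x"]
    by simp
qed

lemma sum_mult_count:
  fixes f :: "'i \<Rightarrow> nat"
  assumes "distinct xs" "set ps \<subseteq> set xs"
  shows "(\<Sum>i<length xs. count_list ps (xs ! i) * f (xs ! i)) = sum_list (map f ps)"
  using sum.reindex_bij_betw[OF bij_betw_nth[OF assms(1) refl refl], of "\<lambda>x. count_list ps x * f x"]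
    sum_list_map_eq_sum_count2[OF assms(2), of f]
  by simp

text \<open>\<open>f\<close> may fail to be injective, as different exponent vectors can give equal
  monomials; the indices are chosen so that \<open>f\<close> is injective on them.\<close>

lemma span_image_explicit:
  fixes f :: "'i \<Rightarrow> 'r::real_vector"
  assumes "u \<in> span (f ` I)"
  obtains S c where "finite S" "S \<subseteq> I" "u = (\<Sum>i\<in>S. c i *\<^sub>R f i)"
proof -
  obtain t r where t: "finite t" "t \<subseteq> f ` I" "u = (\<Sum>a\<in>t. r a *\<^sub>R a)"
    using assms unfolding span_explicit by blast
  then obtain S where S: "S \<subseteq> I" "inj_on f S" "t = f ` S"
    using subset_image_inj[of t f I] by auto
  hence "u = (\<Sum>i\<in>S. r (f i) *\<^sub>R f i)" using t(3) by (simp add: sum.reindex)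
  moreover have "finite S" using S t(1) finite_imageD by blast
  ultimately show thesis using S(1) by (intro that)
qed

lemma coeff_DD_pow: "coeff ((DD A ^^ n) f) = (Dop A ^^ n) (coeff f)"
  by (induction n) (simp_all add: DD_def)

section \<open>Prime transvectants form a Hilbert basis\<close>

context two_halves
begin

definition T :: "cone_elt \<Rightarrow> ('a + 'b) mser" where
  "T c = Ser (Tmap Xa Xg \<alpha> wa \<beta> wb c)"

text \<open>The leading symbol of \<open>T c\<close>; the third component of \<open>c\<close> is the
  power of \<open>x2\<close> that extracts it.\<close>

definition csymb :: "cone_elt \<Rightarrow> ('a + 'b) mser" where
  "csymb c = symb (fst c) (fst (snd c))"

lemma symb_eq: "symb k l = ten (a.mon k) 1 * ten 1 (g.mon l)"
  by (simp add: symb_def ten_mult)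

text \<open>The first form gives access to the abstract transvectant lemmas, the second displays the
  bidegree.\<close>

lemma T_eq:
  "T (k, l, s) = tvt (wsum wa k) (wsum wb l) s (ten (a.mon k) 1) (ten 1 (g.mon l))"
  "T (k, l, s) = (\<Sum>j\<le>s. ((-1) ^ j * (real (s choose j) * fact (nat (wsum wa k - int j))
        / fact (nat (wsum wa k - int s)) * fact (nat (wsum wb l - int s + int j))
        / fact (nat (wsum wb l - int s))))
      *\<^sub>R ten ((DD Xa ^^ j) (a.mon k)) ((DD Xg ^^ (s - j)) (g.mon l)))"
proof -
  show "T (k, l, s) = (\<Sum>j\<le>s. ((-1) ^ j * (real (s choose j) * fact (nat (wsum wa k - int j))
        / fact (nat (wsum wa k - int s)) * fact (nat (wsum wb l - int s + int j))
        / fact (nat (wsum wb l - int s))))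
      *\<^sub>R ten ((DD Xa ^^ j) (a.mon k)) ((DD Xg ^^ (s - j)) (g.mon l)))"
    by (intro mser_eqI)
      (simp add: T_def Tmap_def transv_def coeff_sum ten_def coeff_DD_pow a.mon_def g.mon_def)
  thus "T (k, l, s) = tvt (wsum wa k) (wsum wb l) s (ten (a.mon k) 1) (ten 1 (g.mon l))"
    by (simp add: tvt_def DD_pow_ten ten_mult)
qed

context
  fixes k l s assumes cone: "in_cone wa wb (k, l, s)"
begin

lemma cone_length: "length k = length \<alpha>" "length l = length \<beta>"
  using cone by (auto simp: in_cone_def a.length_ws g.length_ws)

lemma T_prems:
  "x1 (ten (a.mon k) 1) = 0" "z1 (ten (a.mon k) 1) = of_int (wsum wa k) *\<^sub>R ten (a.mon k) 1"
  "x2 ((y1 ^^ j) (ten (a.mon k) 1)) = 0" "z2 ((y1 ^^ j) (ten (a.mon k) 1)) = 0"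
  "x2 (ten 1 (g.mon l)) = 0" "z2 (ten 1 (g.mon l)) = of_int (wsum wb l) *\<^sub>R ten 1 (g.mon l)"
  "x1 ((y2 ^^ j) (ten 1 (g.mon l))) = 0" "z1 ((y2 ^^ j) (ten 1 (g.mon l))) = 0"
  "int s \<le> wsum wa k" "int s \<le> wsum wb l"
  using cone cone_length
  by (simp_all add: DD_pow_ten DD_bdiag_ten ten_linear a.mon_raise a.mon_weight g.mon_raise
      g.mon_weight in_cone_def)

lemma T_kernel: "DD (bdiag Ya Yg) (T (k, l, s)) = 0"
  unfolding T_eq(1) DD_bdiag_split[of Ya Yg] by (rule tvt_kernel) (fact T_prems)+

lemma T_weight:
  "DD (bdiag Za Zg) (T (k, l, s)) = of_int (wsum wa k + wsum wb l - 2 * int s) *\<^sub>R T (k, l, s)"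
  unfolding T_eq(1) DD_bdiag_split[of Za Zg] by (rule tvt_weight) (fact T_prems)+

lemma T_leads: "leads x2 s (T (k, l, s)) (symb k l)"
  unfolding T_eq(1) symb_eq by (rule tvt_leads) (fact T_prems)+

lemma T_bideg: "bideg (a.mdeg k) (g.mdeg l) (T (k, l, s))"
  unfolding T_eq(2)
  by (intro bideg_sum bideg_scaleR bideg_ten wdeg_pow_DD a.wdeg_mon g.wdeg_mon cone_length refl)

end

lemma csymb_foldr:
  assumes "\<And>c. c \<in> set ps \<Longrightarrow> in_cone wa wb c" "(k, l, s) = foldr cadd ps (czero (length \<alpha>) (length \<beta>))"
  shows "prod_list (map csymb ps) = symb k l"
    "sum_list (map (\<lambda>c. snd (snd c)) ps) = s"
    "sum_list (map (\<lambda>c. a.mdeg (fst c)) ps) = a.mdeg k"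
    "sum_list (map (\<lambda>c. g.mdeg (fst (snd c))) ps) = g.mdeg l"
proof -
  have "prod_list (map csymb ps) = symb k l \<and> sum_list (map (\<lambda>c. snd (snd c)) ps) = s \<and>
    sum_list (map (\<lambda>c. a.mdeg (fst c)) ps) = a.mdeg k \<and>
    sum_list (map (\<lambda>c. g.mdeg (fst (snd c))) ps) = g.mdeg l"
    using assms
  proof (induction ps arbitrary: k l s)
    case Nil
    thus ?case by (simp add: czero_def symb_def a.mon_0 g.mon_0 a.mdeg_0 g.mdeg_0)
  next
    case (Cons c ps)
    obtain k' l' s' where r: "(k', l', s') = foldr cadd ps (czero (length \<alpha>) (length \<beta>))"
      by (metis prod_cases3)
    obtain k0 l0 s0 where c: "c = (k0, l0, s0)" by (metis prod_cases3)
    have len: "length k0 = length \<alpha>" "length l0 = length \<beta>" "length k' = length \<alpha>" "length l' = length \<beta>"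
    proof -
      have 1: "cone_len (length \<alpha>) (length \<beta>) d" if "d \<in> set (c # ps)" for d
        using Cons.prems(1)[OF that] in_cone_len[of wa wb d] by (simp add: a.length_ws g.length_ws)
      from 1[of c] show "length k0 = length \<alpha>" "length l0 = length \<beta>"
        by (auto simp: c cone_len_def)
      from foldr_cadd_len[of ps "length \<alpha>" "length \<beta>"] 1
      show "length k' = length \<alpha>" "length l' = length \<beta>" by (auto simp: cone_len_def simp flip: r)
    qed
    have eq: "k = map2 (+) k0 k'" "l = map2 (+) l0 l'" "s = s0 + s'"
    proof -
      have "(k, l, s) = cadd (k0, l0, s0) (k', l', s')"
        using Cons.prems(2) by (simp add: r c)
      thus "k = map2 (+) k0 k'" "l = map2 (+) l0 l'" "s = s0 + s'"
        by (simp_all add: cadd_def)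
    qed
    show ?case
      using Cons.IH[OF _ r] Cons.prems(1)
      by (simp add: eq c csymb_def symb_def a.mon_add g.mon_add a.mdeg_add g.mdeg_add len ten_mult)
  qed
  thus "prod_list (map csymb ps) = symb k l"
    "sum_list (map (\<lambda>c. snd (snd c)) ps) = s"
    "sum_list (map (\<lambda>c. a.mdeg (fst c)) ps) = a.mdeg k"
    "sum_list (map (\<lambda>c. g.mdeg (fst (snd c))) ps) = g.mdeg l" by auto
qed

text \<open>Any enumeration without repetition; its existence amounts to finiteness of the set of
  admissible primes.\<close>

context
  fixes \<pi>s :: "cone_elt list"
  assumes dist: "distinct \<pi>s"
    and primes: "set \<pi>s = {\<pi>. cone_prime wa wb \<pi> \<and> admissible Aa Ag \<pi>}"
begin

definition Tmon :: "nat list \<Rightarrow> ('a + 'b) mser" where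
  "Tmon K = (\<Prod>i<length \<pi>s. T (\<pi>s ! i) ^ (K ! i))"

definition degA :: "nat list \<Rightarrow> nat" where
  "degA K = (\<Sum>i<length \<pi>s. K ! i * a.mdeg (fst (\<pi>s ! i)))"

definition degB :: "nat list \<Rightarrow> nat" where
  "degB K = (\<Sum>i<length \<pi>s. K ! i * g.mdeg (fst (snd (\<pi>s ! i))))"

definition exps :: "nat \<Rightarrow> nat \<Rightarrow> nat list set" where
  "exps d e = {K. length K = length \<pi>s \<and> degA K = d \<and> degB K = e}"

lemma in_cone_prime: "i < length \<pi>s \<Longrightarrow> in_cone wa wb (\<pi>s ! i)"
  using primes nth_mem by (fastforce simp: cone_prime_def)

lemma Tmon_bideg: "bideg (degA K) (degB K) (Tmon K)"
  unfolding Tmon_def degA_def degB_def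
proof (rule bideg_prod_power)
  fix i assume "i \<in> {..<length \<pi>s}"
  thus "bideg (a.mdeg (fst (\<pi>s ! i))) (g.mdeg (fst (snd (\<pi>s ! i)))) (T (\<pi>s ! i))"
    using T_bideg[of "fst (\<pi>s ! i)" "fst (snd (\<pi>s ! i))" "snd (snd (\<pi>s ! i))"] in_cone_prime by simp
qed

lemma Tmon_kernel: "DD (bdiag Ya Yg) (Tmon K) = 0"
  unfolding Tmon_def
proof (subst eigen_prod_power[OF derivation_DD, of _ _ _ "\<lambda>_. 0"])
  fix i assume "i \<in> {..<length \<pi>s}"
  thus "DD (bdiag Ya Yg) (T (\<pi>s ! i)) = 0 *\<^sub>R T (\<pi>s ! i)"
    using T_kernel[of "fst (\<pi>s ! i)" "fst (snd (\<pi>s ! i))" "snd (snd (\<pi>s ! i))"] in_cone_prime by simp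
qed simp

lemma exists_Tmon_leading:
  assumes "in_cone wa wb (k, l, s)" "k \<in> Aa" "l \<in> Ag"
  shows "\<exists>K\<in>exps (a.mdeg k) (g.mdeg l). leads x2 s (Tmon K) (symb k l)"
proof -
  obtain ps where ps: "\<forall>\<pi>\<in>set ps. cone_prime wa wb \<pi> \<and> admissible Aa Ag \<pi>"
    and klm: "(k, l, s) = foldr cadd ps (czero (length \<alpha>) (length \<beta>))"
    using admissible_prime_decomposition[OF a.standard g.standard assms(1)] assms(2,3)
    by (auto simp: admissible_def a.length_ws g.length_ws)
  have cone: "c \<in> set ps \<Longrightarrow> in_cone wa wb c" for c using ps by (simp add: cone_prime_def)
  have sub: "set ps \<subseteq> set \<pi>s" using ps primes by auto
  note sums = csymb_foldr[OF cone klm]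
  \<comment> \<open>The exponents are the multiplicities of the primes in the decomposition.\<close>
  let ?K = "map (count_list ps) \<pi>s"
  have "leads x2 (sum_list (map (\<lambda>c. snd (snd c)) ps)) (prod_list (map T ps)) (prod_list (map csymb ps))"
  proof (rule leads_prod_list[OF derivation_DD])
    fix c assume "c \<in> set ps"
    thus "leads x2 (snd (snd c)) (T c) (csymb c)"
      using T_leads[of "fst c" "fst (snd c)" "snd (snd c)"] cone by (simp add: csymb_def)
  qed
  moreover have "Tmon ?K = prod_list (map T ps)"
    using prod_power_count[OF dist sub, of T] by (simp add: Tmon_def cong: prod.cong_simp)
  ultimately have "leads x2 s (Tmon ?K) (symb k l)" using sums by simp
  moreover have "degA ?K = a.mdeg k" "degB ?K = g.mdeg l"
    unfolding degA_def degB_def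
    using sum_mult_count[OF dist sub, of "\<lambda>c. a.mdeg (fst c)"]
      sum_mult_count[OF dist sub, of "\<lambda>c. g.mdeg (fst (snd c))"] sums
    by (simp_all cong: sum.cong_simp)
  ultimately show ?thesis by (intro bexI[of _ ?K]) (auto simp: exps_def)
qed

text \<open>Since linear maps commute with spans, a \<open>v\<close> in the span with the same image
  under \<open>x2 ^^ s\<close> as \<open>h\<close> is found without naming coefficients;
  \<open>h - v\<close> is killed one power earlier.\<close>

lemma kernel_in_span_Tmon:
  "bideg d e h \<Longrightarrow> DD (bdiag Ya Yg) h = 0 \<Longrightarrow> (x2 ^^ s) h = 0 \<Longrightarrow> h \<in> span (Tmon ` exps d e)"
proof (induction s arbitrary: h)
  case 0
  thus ?case by (simp add: span_zero)
next
  case (Suc s)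
  have lin: "linear (x2 ^^ s)" by (rule linear_funpow) simp
  let ?G = "{symb k l | k l. in_cone wa wb (k, l, s) \<and> k \<in> a.layer d \<and> l \<in> g.layer e}"
  have "(x2 ^^ s) h \<in> span ?G"
    using Suc.prems by (intro leading_term_span) (simp_all add: DD_bdiag_split[of Ya Yg])
  also have "span ?G \<subseteq> span ((x2 ^^ s) ` Tmon ` exps d e)"
  proof (rule span_minimal[OF _ subspace_span], safe)
    fix k l assume kl: "in_cone wa wb (k, l, s)" "k \<in> a.layer d" "l \<in> g.layer e"
    then obtain K where K: "K \<in> exps d e" "leads x2 s (Tmon K) (symb k l)"
      using exists_Tmon_leading[of k l s] by (auto simp: a.layer_def g.layer_def)
    then obtain c where c: "c > 0" "(x2 ^^ s) (Tmon K) = c *\<^sub>R symb k l"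
      by (auto simp: leads_def)
    hence "symb k l = (1 / c) *\<^sub>R (x2 ^^ s) (Tmon K)" by simp
    thus "symb k l \<in> span ((x2 ^^ s) ` Tmon ` exps d e)"
      using K(1) by (auto intro!: span_scale intro: span_base)
  qed
  also have "\<dots> = (x2 ^^ s) ` span (Tmon ` exps d e)"
    by (rule linear_span_image[OF lin])
  finally obtain v where v: "v \<in> span (Tmon ` exps d e)" "(x2 ^^ s) h = (x2 ^^ s) v" by blast
  \<comment> \<open>The induction hypothesis concerns \<open>h - v\<close>, so \<open>v\<close> must
    share the bidegree and the kernel of \<open>h\<close>.\<close>
  have "bideg d e v \<and> DD (bdiag Ya Yg) v = 0"
    using v(1)
  proof (induction rule: span_induct_alt)
    case base
    show ?case by (simp add: bideg_0 DD_0)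
  next
    case (step c u w)
    thus ?case using Tmon_bideg
      by (auto simp: DD_add DD_scaleR Tmon_kernel exps_def intro!: bideg_add bideg_scaleR)
  qed
  hence "h - v \<in> span (Tmon ` exps d e)"
    using Suc.prems v(2) by (intro Suc.IH) (auto intro: bideg_diff simp: DD_diff linear_diff[OF lin])
  from span_add[OF this v(1)] show ?case by simp
qed

lemma smono_Tmon:
  "length K = length \<pi>s \<Longrightarrow> Ser (smono (map (Tmap Xa Xg \<alpha> wa \<beta> wb) \<pi>s) K) = Tmon K"
  by (simp add: Ser_smono Tmon_def T_def)

text \<open>Block-diagonal fields commute with bihomogeneous projection, so each component of
  \<open>f\<close> lies in the kernel and has a finite expansion.\<close>

lemma kernel_lincomb:
  assumes f: "Dop (bdiag Ya Yg) f = mps_zero"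
  shows "is_lincomb (smono (map (Tmap Xa Xg \<alpha> wa \<beta> wb) \<pi>s)) {K. length K = length \<pi>s} f"
proof -
  let ?h = "\<lambda>d e. bitrunc d e (Ser f)"
  have f0: "DD (bdiag Ya Yg) (Ser f) = 0"
    by (simp add: DD_def f mps_zero_def zero_mser_def)
  define P where "P d e S c \<longleftrightarrow> finite S \<and> S \<subseteq> exps d e \<and> ?h d e = (\<Sum>K\<in>S. c K *\<^sub>R Tmon K)"
    for d e S and c :: "nat list \<Rightarrow> real"
  have "\<exists>S c. P d e S c" for d e
  proof -
    obtain N where N: "\<And>u. bideg d e u \<Longrightarrow> (x2 ^^ N) u = 0"
      using DD_bdiag_nilpotent[OF sl2_triad_0 g.triad] by blast
    have "DD (bdiag Ya Yg) (?h d e) = 0"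
      unfolding DD_bitrunc f0 by (rule mser_eqI) (simp add: bitrunc_def trunc_def)
    from kernel_in_span_Tmon[OF bideg_bitrunc this N[OF bideg_bitrunc]]
    obtain S c where "finite S" "S \<subseteq> exps d e" "?h d e = (\<Sum>K\<in>S. c K *\<^sub>R Tmon K)"
      by (rule span_image_explicit)
    thus ?thesis unfolding P_def by blast
  qed
  then obtain S C where "\<And>d e. P d e (S d e) (C d e)" by metis
  hence SC: "\<And>d e. finite (S d e)" "\<And>d e. S d e \<subseteq> exps d e"
    "\<And>d e. ?h d e = (\<Sum>K\<in>S d e. C d e K *\<^sub>R Tmon K)"
    unfolding P_def by blast+
  have deg: "degA K = d" "degB K = e" "length K = length \<pi>s" if "K \<in> S d e" for K d e
    using SC(2)[of d e] that by (auto simp: exps_def)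
  \<comment> \<open>Each \<open>K\<close> has one bidegree, so it takes its coefficient from that
    component, or 0 if it does not occur there; the choices for different components cannot
    conflict.\<close>
  define c where "c K = (if K \<in> S (degA K) (degB K) then C (degA K) (degB K) K else 0)" for K
  have fin: "finite {K \<in> {K. length K = length \<pi>s}. c K * coeff (Tmon K) m \<noteq> 0} \<and>
     f m = (\<Sum>K\<in>{K \<in> {K. length K = length \<pi>s}. c K * coeff (Tmon K) m \<noteq> 0}. c K * coeff (Tmon K) m)" for m
  proof -
    let ?d = "wt (\<lambda>_. 1) (lpart m)" and ?e = "wt (\<lambda>_. 1) (rpart m)"
    let ?R = "{K \<in> {K. length K = length \<pi>s}. c K * coeff (Tmon K) m \<noteq> 0}"
    \<comment> \<open>Local finiteness: only monomials of the bidegree of \<open>m\<close> have a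
      nonzero coefficient at \<open>m\<close>.\<close>
    have sub: "?R \<subseteq> S ?d ?e"
    proof
      fix K assume K: "K \<in> ?R"
      hence "?d = degA K" "?e = degB K" using Tmon_bideg[of K] unfolding bideg_iff by auto
      thus "K \<in> S ?d ?e" using K by (auto simp: c_def split: if_splits)
    qed
    have "f m = coeff (?h ?d ?e) m" by (simp only: coeff_bitrunc coeff_Ser)
    also have "\<dots> = (\<Sum>K\<in>S ?d ?e. c K * coeff (Tmon K) m)"
      unfolding SC(3) coeff_sum coeff_scaleR
      by (rule sum.cong[OF refl]) (simp add: c_def deg)
    also have "\<dots> = (\<Sum>K\<in>?R. c K * coeff (Tmon K) m)"
      using sub SC(1) deg(3) by (intro sum.mono_neutral_right) auto
    finally show ?thesis using finite_subset[OF sub SC(1)] by simp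
  qed
  let ?F = "smono (map (Tmap Xa Xg \<alpha> wa \<beta> wb) \<pi>s)"
  have F: "?F K = coeff (Tmon K)" if "length K = length \<pi>s" for K
    by (simp flip: smono_Tmon[OF that])
  show ?thesis
    unfolding is_lincomb_def
  proof (intro exI[of _ c] allI)
    fix m
    let ?R = "{K \<in> {K. length K = length \<pi>s}. c K * coeff (Tmon K) m \<noteq> 0}"
    have R: "{K \<in> {K. length K = length \<pi>s}. c K * ?F K m \<noteq> 0} = ?R" by (auto simp: F)
    have sum: "(\<Sum>K\<in>?R. c K * ?F K m) = (\<Sum>K\<in>?R. c K * coeff (Tmon K) m)"
      by (rule sum.cong) (auto simp: F)
    show "finite {K \<in> {K. length K = length \<pi>s}. c K * ?F K m \<noteq> 0} \<and>
        f m = (\<Sum>K\<in>{K \<in> {K. length K = length \<pi>s}. c K * ?F K m \<noteq> 0}. c K * ?F K m)"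
      unfolding R sum by (rule fin)
  qed
qed

theorem prime_transvectants_hilbert_basis:
  "\<exists>ws. hilbert_basis (Dop (bdiag Ya Yg)) (Dop (bdiag Za Zg)) (map (Tmap Xa Xg \<alpha> wa \<beta> wb) \<pi>s) ws"
proof (intro exI)
  \<comment> \<open>The weights of the two factors add, and each of the \<open>s\<close> lowerings
    costs 2.\<close>
  let ?w = "\<lambda>(k, l, s). wsum wa k + wsum wb l - 2 * int s"
  show "hilbert_basis (Dop (bdiag Ya Yg)) (Dop (bdiag Za Zg)) (map (Tmap Xa Xg \<alpha> wa \<beta> wb) \<pi>s) (map ?w \<pi>s)"
    unfolding hilbert_basis_def
  proof (intro conjI allI impI)
    fix i assume "i < length (map (Tmap Xa Xg \<alpha> wa \<beta> wb) \<pi>s)"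
    hence i: "i < length \<pi>s" by simp
    obtain k l s where c: "\<pi>s ! i = (k, l, s)" by (metis prod_cases3)
    hence cone: "in_cone wa wb (k, l, s)" using in_cone_prime[OF i] by simp
    have Tc: "coeff (T (k, l, s)) = map (Tmap Xa Xg \<alpha> wa \<beta> wb) \<pi>s ! i"
      using i c by (simp add: T_def)
    show "Dop (bdiag Ya Yg) (map (Tmap Xa Xg \<alpha> wa \<beta> wb) \<pi>s ! i) = mps_zero"
      using T_kernel[OF cone] by (simp add: DD_def Tc zero_mser_def mps_zero_def)
    show "homogeneous (map (Tmap Xa Xg \<alpha> wa \<beta> wb) \<pi>s ! i)"
      using bideg_wdeg[OF T_bideg[OF cone]] unfolding homogeneous_def wdeg_def Tc
      by (auto simp: wt_def)
    show "Dop (bdiag Za Zg) (map (Tmap Xa Xg \<alpha> wa \<beta> wb) \<pi>s ! i)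
        = (\<lambda>m. of_int (map ?w \<pi>s ! i) * (map (Tmap Xa Xg \<alpha> wa \<beta> wb) \<pi>s ! i) m)"
      using T_weight[OF cone] i c by (simp add: DD_def Tc scaleR_mser_def)
  next
    fix f assume "Dop (bdiag Ya Yg) f = mps_zero"
    from kernel_lincomb[OF this]
    show "is_lincomb (smono (map (Tmap Xa Xg \<alpha> wa \<beta> wb) \<pi>s))
        {k. length k = length (map (Tmap Xa Xg \<alpha> wa \<beta> wb) \<pi>s)} f"
      by simp
  qed simp
qed

end

end

theorem theorem11p7:
  fixes Xa Ya Za :: "real^'a::finite^'a" and Xg Yg Zg :: "real^'b::finite^'b"
    and \<alpha> :: "'a mps list" and wa :: "int list" and Aa :: "nat list set"
    and \<beta> :: "'b mps list" and wb :: "int list" and Ag :: "nat list set"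
  assumes "sl2_triad Xa Ya Za" and "sl2_triad Xg Yg Zg"
    and "hilbert_basis (Dop Ya) (Dop Za) \<alpha> wa"
    and "hilbert_basis (Dop Yg) (Dop Zg) \<beta> wb"
    and "preferred_set (Dop Ya) \<alpha> Aa" and "standard_set Aa"
    and "preferred_set (Dop Yg) \<beta> Ag" and "standard_set Ag"
  shows "(\<forall>c. in_cone wa wb c \<and> admissible Aa Ag c \<longrightarrow>
            (\<exists>ps. (\<forall>\<pi>\<in>set ps. cone_prime wa wb \<pi> \<and> admissible Aa Ag \<pi>)
                  \<and> c = foldr cadd ps (czero (length \<alpha>) (length \<beta>))))
       \<and> (\<forall>\<pi>s. distinct \<pi>s \<and> set \<pi>s = {\<pi>. cone_prime wa wb \<pi> \<and> admissible Aa Ag \<pi>} \<longrightarrow>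
            (\<exists>ws. hilbert_basis (Dop (bdiag Ya Yg)) (Dop (bdiag Za Zg))
                     (map (Tmap Xa Xg \<alpha> wa \<beta> wb) \<pi>s) ws))"
proof -
  interpret two_halves Xa Ya Za \<alpha> wa Aa Xg Yg Zg \<beta> wb Ag
    by (intro two_halves.intro half.intro assms)
  show ?thesis
    using admissible_prime_decomposition[OF assms(6,8), of wa wb] prime_transvectants_hilbert_basis
    by (simp add: a.length_ws g.length_ws)
qed

end
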